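(* Let $G$ be a finite group, $u\in G$ a central element with $u^2=1$, $u\neq1$, and let $k$ be a field whose characteristic is zero or does not divide $|G|$. Then $H^2(G,k^\cdot)\cong H^2_\sharp(G,k^\cdot)$ as groups in each of the following cases: 1. $-1$ is a square in $k$; 2. $G$ is nilpotent, its Sylow $2$-subgroup $S_2$ is abelian, and $u$ is contained in a direct product (inside $S_2$) of cyclic $2$-groups none of which is isomorphic to $\mathbb Z_2$; 3. $G$ is nilpotent, its Sylow $2$-subgroup $S_2$ is abelian, and $S_2\cong\prod_{i\ge1}\mathbb Z_{n_i}$ (a finite product) with $n_i=2^{e_i}$ and $e_i\geq2$ for $i\geq2$.
   Context: $k^\cdot=k\setminus\{0\}$ with trivial $G$-action. The group $H^2_\sharp(G,k^\cdot)$: for a normalized $2$-cocycle $\sigma\in Z^2(G,k^\cdot)$ and $g\in G$ put $\theta(\sigma)(g,u)=\sigma(g,u)\sigma(u,g)^{-1}\in\{\pm1\}$ and define $|g|_\sigma\in\{0,1\}$ by $(-1)^{|g|_\sigma}=\theta(\sigma)(g,u)$. Then $(\sigma\sharp\omega)(g,h)=\sigma(g,h)\omega(g,h)(-1)^{|g|_\sigma|h|_\omega}$ defines a group structure on $Z^2(G,k^\cdot)$ inducing an abelian group structure on the set $H^2(G,k^\cdot)$; the resulting group is $H^2_\sharp(G,k^\cdot)$. *)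

theory Defs
  imports "HOL-Algebra.Algebra"
begin

definition twococycles :: "('a, 'm) monoid_scheme \<Rightarrow> ('b, 'n) monoid_scheme \<Rightarrow> ('a \<times> 'a \<Rightarrow> 'b) set"
  where "twococycles G A = {\<sigma> \<in> carrier G \<times> carrier G \<rightarrow>\<^sub>E carrier A.
    (\<forall>g\<in>carrier G. \<sigma> (g, \<one>\<^bsub>G\<^esub>) = \<one>\<^bsub>A\<^esub> \<and> \<sigma> (\<one>\<^bsub>G\<^esub>, g) = \<one>\<^bsub>A\<^esub>) \<and>
    (\<forall>g\<in>carrier G. \<forall>h\<in>carrier G. \<forall>l\<in>carrier G.
       \<sigma> (g, h) \<otimes>\<^bsub>A\<^esub> \<sigma> (g \<otimes>\<^bsub>G\<^esub> h, l) = \<sigma> (h, l) \<otimes>\<^bsub>A\<^esub> \<sigma> (g, h \<otimes>\<^bsub>G\<^esub> l))}"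
  \<comment> \<open>Normalized 2-cocycles of \<open>G\<close> with values in the abelian group \<open>A\<close> with trivial action.
      The functions are extensional, so that equality of cocycles is equality of functions.\<close>

definition coboundary :: "('a, 'm) monoid_scheme \<Rightarrow> ('b, 'n) monoid_scheme \<Rightarrow> ('a \<Rightarrow> 'b) \<Rightarrow> 'a \<times> 'a \<Rightarrow> 'b"
  where "coboundary G A \<gamma> = restrict
    (\<lambda>(g, h). \<gamma> g \<otimes>\<^bsub>A\<^esub> \<gamma> h \<otimes>\<^bsub>A\<^esub> inv\<^bsub>A\<^esub> \<gamma> (g \<otimes>\<^bsub>G\<^esub> h)) (carrier G \<times> carrier G)"

definition twocoboundaries :: "('a, 'm) monoid_scheme \<Rightarrow> ('b, 'n) monoid_scheme \<Rightarrow> ('a \<times> 'a \<Rightarrow> 'b) set"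
  where "twocoboundaries G A =
    {coboundary G A \<gamma> | \<gamma>. \<gamma> \<in> carrier G \<rightarrow> carrier A \<and> \<gamma> \<one>\<^bsub>G\<^esub> = \<one>\<^bsub>A\<^esub>}"
  \<comment> \<open>The condition \<open>\<gamma> 1 = 1\<close> says exactly that the coboundary is normalized.\<close>

definition Z2 :: "('a, 'm) monoid_scheme \<Rightarrow> ('b, 'n) monoid_scheme \<Rightarrow> ('a \<times> 'a \<Rightarrow> 'b) monoid"
  where "Z2 G A = (product_group (carrier G \<times> carrier G) (\<lambda>_. A))\<lparr>carrier := twococycles G A\<rparr>"

definition H2 :: "('a, 'm) monoid_scheme \<Rightarrow> ('b, 'n) monoid_scheme \<Rightarrow> ('a \<times> 'a \<Rightarrow> 'b) set monoid"
  where "H2 G A = Z2 G A Mod twocoboundaries G A"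

definition theta :: "('b, 'n) monoid_scheme \<Rightarrow> ('a \<times> 'a \<Rightarrow> 'b) \<Rightarrow> 'a \<Rightarrow> 'a \<Rightarrow> 'b"
  where "theta A \<sigma> g h = \<sigma> (g, h) \<otimes>\<^bsub>A\<^esub> inv\<^bsub>A\<^esub> \<sigma> (h, g)"

definition cocycle_parity :: "('c, 'n) ring_scheme \<Rightarrow> 'a \<Rightarrow> ('a \<times> 'a \<Rightarrow> 'c) \<Rightarrow> 'a \<Rightarrow> nat"
  where "cocycle_parity K u \<sigma> g =
    (THE e. e \<in> {0, 1} \<and> (\<ominus>\<^bsub>K\<^esub> \<one>\<^bsub>K\<^esub>) [^]\<^bsub>K\<^esub> e = theta (Multiplicative_Group.mult_of K) \<sigma> g u)"
  \<comment> \<open>The number \<open>|g|\<^sub>\<sigma>\<close>. It exists and is unique if \<open>\<sigma>\<close> is a normalized cocycle, \<open>u\<close> is central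
      with \<open>u\<^sup>2 = 1\<close>, and \<open>-1 \<noteq> 1\<close> in \<open>K\<close>: \<open>theta\<close> is multiplicative in \<open>u\<close>, hence is a square
      root of \<open>1\<close>.\<close>

definition Z2_sharp ::
    "('a, 'm) monoid_scheme \<Rightarrow> 'a \<Rightarrow> ('c, 'n) ring_scheme \<Rightarrow> ('a \<times> 'a \<Rightarrow> 'c) monoid"
  where "Z2_sharp G u K = (Z2 G (Multiplicative_Group.mult_of K))\<lparr>monoid.mult := (\<lambda>\<sigma> \<omega>. restrict
    (\<lambda>(g, h). \<sigma> (g, h) \<otimes>\<^bsub>K\<^esub> \<omega> (g, h) \<otimes>\<^bsub>K\<^esub>
       (\<ominus>\<^bsub>K\<^esub> \<one>\<^bsub>K\<^esub>) [^]\<^bsub>K\<^esub> (cocycle_parity K u \<sigma> g * cocycle_parity K u \<omega> h))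
    (carrier G \<times> carrier G))\<rparr>"

definition H2_sharp ::
    "('a, 'm) monoid_scheme \<Rightarrow> 'a \<Rightarrow> ('c, 'n) ring_scheme \<Rightarrow> ('a \<times> 'a \<Rightarrow> 'c) set monoid"
  where "H2_sharp G u K = Z2_sharp G u K Mod twocoboundaries G (Multiplicative_Group.mult_of K)"
  \<comment> \<open>Coboundaries have parity \<open>0\<close> (as \<open>u\<close> is central), so on them the twisted product is the
      pointwise one, and their cosets in \<open>Z2_sharp\<close> are the same sets as in \<open>Z2\<close>.\<close>

definition ring_characteristic :: "('c, 'n) ring_scheme \<Rightarrow> nat"
  where "ring_characteristic K = group.ord (add_monoid K) \<one>\<^bsub>K\<^esub>"
  \<comment> \<open>\<open>group.ord\<close> is \<open>0\<close> for elements of infinite order.\<close>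

primrec upper_central :: "('a, 'm) monoid_scheme \<Rightarrow> nat \<Rightarrow> 'a set"
  where
    "upper_central G 0 = {\<one>\<^bsub>G\<^esub>}"
  | "upper_central G (Suc n) = {g \<in> carrier G. \<forall>h\<in>carrier G.
       g \<otimes>\<^bsub>G\<^esub> h \<otimes>\<^bsub>G\<^esub> inv\<^bsub>G\<^esub> g \<otimes>\<^bsub>G\<^esub> inv\<^bsub>G\<^esub> h \<in> upper_central G n}"
  \<comment> \<open>The preimage of the centre of \<open>G / Z\<^sub>n\<close>: an element is central modulo \<open>Z\<^sub>n\<close> iff all its
      commutators lie in \<open>Z\<^sub>n\<close>.\<close>

definition nilpotent_group :: "('a, 'm) monoid_scheme \<Rightarrow> bool"
  where "nilpotent_group G \<longleftrightarrow> (\<exists>n. upper_central G n = carrier G)"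

definition sylow_subgroup :: "nat \<Rightarrow> 'a set \<Rightarrow> ('a, 'm) monoid_scheme \<Rightarrow> bool"
  where "sylow_subgroup p S G \<longleftrightarrow> subgroup S G \<and> card S = p ^ multiplicity p (order G)"

end

theory Submission
  imports Defs "HOL-Number_Theory.Cong"
begin

text \<open>Both groups have the same underlying set of classes, and their products differ by the class of
  the sign form \<open>(-1)\<close> to the power \<open>|g|\<^sub>\<sigma> |h|\<^sub>\<omega>\<close>. If all the diagonal forms, with \<open>\<omega> = \<sigma>\<close>, are coboundaries,
  this is an alternating pairing on \<open>H\<^sup>2\<close> with values in its radical. It then has a
  quadratic refinement \<open>q\<close> with values in the radical, and \<open>c \<mapsto> c q(c)\<close> is an isomorphism.

  A diagonal form is the coboundary of \<open>g \<mapsto> x\<close> to the power \<open>|g|\<^sub>\<sigma>\<close> if \<open>x\<^sup>2 = -1\<close>, and of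
  \<open>g \<mapsto> (-1)\<close> to the power \<open>\<lfloor>L(g)/2\<rfloor>\<close> if the parity lifts to a homomorphism \<open>L\<close> into \<open>\<int>/4\<close>. By transfer it
  suffices to find such a lift on a Sylow \<open>2\<close>-subgroup \<open>S\<close>. In the second case \<open>u = v\<^sup>2\<close> with
  \<open>v \<in> S\<close>, so that \<open>\<theta>(s,u) = \<theta>(s,v)\<^sup>2\<close> for \<open>s \<in> S\<close>: either \<open>-1\<close> is a square or the parity vanishes on \<open>S\<close>.
  In the third case the generator of a factor of order \<open>2\<close> has parity \<open>0\<close>, and the parity
  lifts factor by factor.\<close>

section \<open>Quadratic refinements of alternating pairings\<close>

text \<open>Applied to \<open>H2\<close> with the pairing by sign forms. The group itself may be
  infinite, so finiteness is asked of the set of functions \<open>b x\<close>, which bounds the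
  index of the radical.\<close>

locale alternating_pairing = comm_group A for A (structure) +
  fixes b
  assumes pairing_closed [simp]: "x \<in> carrier A \<Longrightarrow> y \<in> carrier A \<Longrightarrow> b x y \<in> carrier A"
    and pairing_mult_left: "\<lbrakk>x \<in> carrier A; y \<in> carrier A; z \<in> carrier A\<rbrakk> \<Longrightarrow> b (x \<otimes> y) z = b x z \<otimes> b y z"
    and pairing_mult_right: "\<lbrakk>x \<in> carrier A; y \<in> carrier A; z \<in> carrier A\<rbrakk> \<Longrightarrow> b z (x \<otimes> y) = b z x \<otimes> b z y"
    and pairing_self: "x \<in> carrier A \<Longrightarrow> b x x = \<one>"
    and pairing_square: "\<lbrakk>x \<in> carrier A; y \<in> carrier A\<rbrakk> \<Longrightarrow> b x y \<otimes> b x y = \<one>"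
    and pairing_pairing: "\<lbrakk>x \<in> carrier A; y \<in> carrier A; z \<in> carrier A\<rbrakk> \<Longrightarrow> b (b x y) z = \<one>"
    and finite_pairing: "finite (b ` carrier A)"
begin

definition radical :: "'a set"
  where "radical = {x \<in> carrier A. \<forall>z\<in>carrier A. b x z = \<one>}"

text \<open>Values in the radical are invisible to the pairing, and triviality on the radical makes
  q constant on its cosets. Both are what makes \<open>x \<mapsto> x \<otimes> q x\<close> bijective
  and compatible with the twisted product.\<close>

definition quadratic_refinement :: "'a set \<Rightarrow> ('a \<Rightarrow> 'a) \<Rightarrow> bool"
  where "quadratic_refinement Y q \<longleftrightarrow> subgroup Y A \<and> radical \<subseteq> Y \<and> q ` Y \<subseteq> radical \<and>
    (\<forall>x\<in>radical. q x = \<one>) \<and> (\<forall>x\<in>Y. \<forall>y\<in>Y. q (x \<otimes> y) = q x \<otimes> q y \<otimes> b x y)"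

lemma pairing_cancel: "\<lbrakk>x \<in> carrier A; y \<in> carrier A; a \<in> carrier A\<rbrakk> \<Longrightarrow> b x y \<otimes> (b x y \<otimes> a) = a"
  by (metis l_one m_assoc pairing_closed pairing_square)

text \<open>Polarization: expanding the trivial value at
  \<open>(x \<otimes> y, x \<otimes> y)\<close> leaves
  \<open>b x y \<otimes> b y x = \<one>\<close>, and each value is its own inverse.\<close>

lemma pairing_commute:
  assumes "x \<in> carrier A" "y \<in> carrier A"
  shows "b x y = b y x"
proof -
  have "b (x \<otimes> y) (x \<otimes> y) = b x y \<otimes> b y x"
    using assms by (simp add: pairing_mult_left pairing_mult_right pairing_self del: pairing_self)
      (simp add: pairing_self m_ac)
  then have "b x y \<otimes> b y x = \<one>"
    using assms by (simp add: pairing_self)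
  then show ?thesis
    using assms pairing_cancel [of x y "b y x"] by simp
qed

lemma pairing_one_left: "z \<in> carrier A \<Longrightarrow> b \<one> z = \<one>"
  using pairing_mult_left [of \<one> \<one> z] pairing_square [of \<one> z] by simp

lemma pairing_inv_left: "\<lbrakk>x \<in> carrier A; z \<in> carrier A\<rbrakk> \<Longrightarrow> b (inv x) z = b x z"
  using pairing_mult_left [of "inv x" x z] pairing_one_left [of z] pairing_cancel [of x z "b (inv x) z"]
  by (metis inv_closed l_inv m_comm pairing_cancel pairing_closed r_one)

lemma subgroup_radical: "subgroup radical A"
  by unfold_locales
    (auto simp: radical_def pairing_mult_left pairing_one_left pairing_inv_left)

lemma radical_closed: "x \<in> radical \<Longrightarrow> x \<in> carrier A"
  by (simp add: radical_def)

lemma pairing_in_radical: "\<lbrakk>x \<in> carrier A; y \<in> carrier A\<rbrakk> \<Longrightarrow> b x y \<in> radical"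
  by (simp add: radical_def pairing_pairing)

text \<open>Adjoining one element to a subgroup above the radical therefore adds at most one
  coset.\<close>

lemma square_in_radical: "x \<in> carrier A \<Longrightarrow> x \<otimes> x \<in> radical"
  by (simp add: radical_def pairing_mult_left pairing_square)

lemma pairing_radical_left: "\<lbrakk>r \<in> radical; x \<in> carrier A\<rbrakk> \<Longrightarrow> b r x = \<one>"
  by (simp add: radical_def)

lemma pairing_radical_right: "\<lbrakk>r \<in> radical; x \<in> carrier A\<rbrakk> \<Longrightarrow> b x r = \<one>"
  by (simp add: radical_def pairing_commute)

text \<open>The radical is the kernel of \<open>x \<mapsto> b x\<close>; this turns a coincidence of
  functions into membership in a subgroup above the radical.\<close>

lemma same_pairing_imp_radical:
  assumes "x \<in> carrier A" "y \<in> carrier A" "\<And>z. z \<in> carrier A \<Longrightarrow> b x z = b y z"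
  shows "x \<otimes> inv y \<in> radical"
  using assms by (simp add: radical_def pairing_mult_left pairing_inv_left pairing_square)

lemma quadratic_refinement_radical: "quadratic_refinement radical (\<lambda>_. \<one>)"
  using subgroup_radical radical_closed
  by (auto simp: quadratic_refinement_def pairing_radical_left subgroup.one_closed)

text \<open>As \<open>c \<otimes> c\<close> lies in the radical, \<open>Y'\<close> consists of Y and
  one coset of it. If c is new, the values on that coset are forced by the choice of \<one> as the
  value at c, which is consistent because \<open>b c c\<close> and \<open>q (c \<otimes> c)\<close>
  are both trivial.\<close>

lemma quadratic_refinement_extend:
  assumes q: "quadratic_refinement Y q" and c: "c \<in> carrier A"
  defines "Y' \<equiv> {z \<in> carrier A. z \<in> Y \<or> z \<otimes> c \<in> Y}"
  shows "quadratic_refinement Y' (\<lambda>z. if z \<in> Y then q z else q (z \<otimes> c) \<otimes> b z c)"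
    (is "quadratic_refinement Y' ?q")
proof -
  have Y: "subgroup Y A" and R: "radical \<subseteq> Y" and qR: "\<And>y. y \<in> Y \<Longrightarrow> q y \<in> radical"
    and q1: "\<And>y. y \<in> radical \<Longrightarrow> q y = \<one>"
    and qm: "\<And>x y. x \<in> Y \<Longrightarrow> y \<in> Y \<Longrightarrow> q (x \<otimes> y) = q x \<otimes> q y \<otimes> b x y"
    using q by (auto simp: quadratic_refinement_def)
  interpret Y: subgroup Y A by (fact Y)
  have qc: "\<And>y. y \<in> Y \<Longrightarrow> q y \<in> carrier A"
    using qR radical_closed by blast
  have Yc: "\<And>y. y \<in> Y \<Longrightarrow> y \<in> carrier A" by simp
  have cc: "c \<otimes> c \<in> Y"
    using square_in_radical [OF c] R by blast
  have quot: "x \<in> Y" if "x \<otimes> y \<in> Y" "y \<in> Y" "x \<in> carrier A" for x y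
  proof -
    have "x = (x \<otimes> y) \<otimes> inv y"
      using that Yc by (simp add: m_assoc)
    then show ?thesis using that by (metis Y.m_closed Y.m_inv_closed)
  qed
  \<comment> \<open>The product of \<open>z \<otimes> c\<close> and \<open>w \<otimes> c\<close> is
    \<open>z \<otimes> w\<close> times \<open>c \<otimes> c\<close>, and this square can be divided
    out inside Y.\<close>
  have both: "z \<otimes> w \<in> Y" if "z \<otimes> c \<in> Y" "w \<otimes> c \<in> Y" "z \<in> carrier A" "w \<in> carrier A" for z w
  proof (rule quot [OF _ cc])
    have "(z \<otimes> c) \<otimes> (w \<otimes> c) \<in> Y" using that by simp
    then show "z \<otimes> w \<otimes> (c \<otimes> c) \<in> Y" using that c by (simp add: m_ac)
  qed (use that in simp)
  have mult: "z \<otimes> w \<otimes> c \<in> Y" if "z \<in> Y" "w \<otimes> c \<in> Y" "w \<in> carrier A" for z w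
    using that Y.m_closed [OF that(1,2)] Yc c by (simp add: m_assoc)
  have notin: "z \<otimes> w \<notin> Y" if "z \<in> Y" "w \<notin> Y" "w \<in> carrier A" for z w
    using quot [of w z] that Yc by (auto simp: m_comm)
  have sub: "subgroup Y' A"
  proof
    show "Y' \<subseteq> carrier A" by (auto simp: Y'_def)
    show "x \<otimes> y \<in> Y'" if "x \<in> Y'" "y \<in> Y'" for x y
      using that mult [of x y] mult [of y x] both [of x y]
      by (auto simp: Y'_def m_comm)
    show "\<one> \<in> Y'" by (simp add: Y'_def)
    show "inv x \<in> Y'" if "x \<in> Y'" for x
    proof -
      have "inv x \<otimes> c \<in> Y" if "x \<in> carrier A" "x \<otimes> c \<in> Y"
      proof -
        have "inv x \<otimes> c = inv (x \<otimes> c) \<otimes> (c \<otimes> c)"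
          using that c by (simp add: inv_mult m_assoc) (simp add: m_assoc [symmetric])
        then show ?thesis using that cc by (metis Y.m_closed Y.m_inv_closed)
      qed
      then show ?thesis using that by (auto simp: Y'_def)
    qed
  qed
  have one_out: "?q (z \<otimes> w) = ?q z \<otimes> ?q w \<otimes> b z w"
    if zw: "z \<in> Y" "w \<notin> Y" "w \<otimes> c \<in> Y" "w \<in> carrier A" for z w
  proof -
    have "?q (z \<otimes> w) = q (z \<otimes> (w \<otimes> c)) \<otimes> b (z \<otimes> w) c"
      using notin [OF zw(1,2,4)] zw Yc c by (simp add: m_assoc)
    also have "\<dots> = q z \<otimes> q (w \<otimes> c) \<otimes> (b z w \<otimes> b z c) \<otimes> (b z c \<otimes> b w c)"
      using zw Yc c by (simp add: qm pairing_mult_left pairing_mult_right)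
    \<comment> \<open>The factor \<open>b z c\<close> comes once from expanding q on Y and once from
      the formula for the new values; the two cancel.\<close>
    also have "\<dots> = q z \<otimes> (q (w \<otimes> c) \<otimes> b w c) \<otimes> b z w"
      using zw Yc c qc by (simp add: m_ac pairing_cancel)
    finally show ?thesis using zw by simp
  qed
  have both_out: "?q (z \<otimes> w) = ?q z \<otimes> ?q w \<otimes> b z w"
    if zw: "z \<notin> Y" "z \<otimes> c \<in> Y" "z \<in> carrier A" "w \<notin> Y" "w \<otimes> c \<in> Y" "w \<in> carrier A" for z w
  proof -
    have zwY: "z \<otimes> w \<in> Y" using both zw by simp
    have "b (z \<otimes> c) (w \<otimes> c) = b z w \<otimes> b z c \<otimes> (b c w \<otimes> b c c)"
      using zw c by (simp add: pairing_mult_left pairing_mult_right m_ac)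
    then have b: "b (z \<otimes> c) (w \<otimes> c) = b z w \<otimes> b z c \<otimes> b w c"
      using zw c by (simp add: pairing_self pairing_commute [of c w])
    \<comment> \<open>Both q and the pairing are trivial at \<open>c \<otimes> c\<close>, so
      inserting it changes nothing and turns the argument into a product of two elements of
      Y.\<close>
    have "q (z \<otimes> w) = q (z \<otimes> w) \<otimes> q (c \<otimes> c) \<otimes> b (z \<otimes> w) (c \<otimes> c)"
      using zw c square_in_radical [OF c] q1 qc [OF zwY] pairing_radical_right by simp
    also have "\<dots> = q ((z \<otimes> c) \<otimes> (w \<otimes> c))"
      using qm [OF zwY cc] zw c by (simp add: m_ac)
    also have "\<dots> = q (z \<otimes> c) \<otimes> q (w \<otimes> c) \<otimes> (b z w \<otimes> b z c \<otimes> b w c)"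
      using qm zw b by simp
    also have "\<dots> = (q (z \<otimes> c) \<otimes> b z c) \<otimes> (q (w \<otimes> c) \<otimes> b w c) \<otimes> b z w"
      using zw c qc by (simp only: m_ac pairing_closed m_closed)
    finally show ?thesis
      using zw zwY by simp
  qed
  have "?q (z \<otimes> w) = ?q z \<otimes> ?q w \<otimes> b z w" if zw: "z \<in> Y'" "w \<in> Y'" for z w
  proof -
    have c': "z \<in> carrier A" "w \<in> carrier A" using zw by (auto simp: Y'_def)
    have out: "x \<otimes> c \<in> Y" if "x \<in> {z, w}" "x \<notin> Y" for x
      using that zw by (auto simp: Y'_def)
    consider "z \<in> Y" "w \<in> Y" | "z \<in> Y" "w \<notin> Y" | "z \<notin> Y" "w \<in> Y" | "z \<notin> Y" "w \<notin> Y"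
      by blast
    then show ?thesis
    proof cases
      case 1
      then show ?thesis by (simp add: qm)
    next
      case 2
      then show ?thesis using out c' by (intro one_out) auto
    next
      case 3
      \<comment> \<open>By symmetry of the pairing this is the mixed case with the factors
        exchanged.\<close>
      then have "?q (w \<otimes> z) = ?q w \<otimes> ?q z \<otimes> b w z"
        using out c' by (intro one_out) auto
      moreover have "q z' \<otimes> b z c \<in> carrier A" if "z' \<in> Y" for z'
        using that qc c c' by simp
      ultimately show ?thesis
        using 3 out [of z] c' qc
        by (simp only: m_comm [of w z] pairing_commute [of w z] if_True if_False)
          (simp add: m_comm [of "q w"])
    next
      case 4
      then show ?thesis using out c' by (intro both_out) auto
    qed
  qed
  moreover have "?q x \<in> radical" if "x \<in> Y'" for x
    using that c qR subgroup.m_closed [OF subgroup_radical] pairing_in_radical by (auto simp: Y'_def)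
  moreover have "radical \<subseteq> Y'" using R radical_closed by (auto simp: Y'_def)
  moreover have "?q x = \<one>" if "x \<in> radical" for x using that R q1 by auto
  ultimately show ?thesis
    unfolding quadratic_refinement_def using sub by blast
qed

text \<open>Among the subgroups that carry a refinement one maximizes the number of functions
  \<open>b y\<close>, a bounded natural number. Adjoining c to a maximal Y yields no new function,
  so \<open>b c = b y\<close> for some y in Y; then c and y differ by an element of the radical, and
  c lies in Y.\<close>

lemma quadratic_refinement_exists: "\<exists>q. quadratic_refinement (carrier A) q"
proof -
  let ?P = "\<lambda>Y. \<exists>q. quadratic_refinement Y q"
  have sub: "Y \<subseteq> carrier A" if "?P Y" for Y
    using that by (auto simp: quadratic_refinement_def dest: subgroup.mem_carrier)
  have "\<forall>Y. ?P Y \<longrightarrow> card (b ` Y) < Suc (card (b ` carrier A))"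
    using sub finite_pairing by (auto simp: less_Suc_eq_le intro!: card_mono)
  then obtain Y q where q: "quadratic_refinement Y q"
    and max: "\<And>Z. ?P Z \<Longrightarrow> card (b ` Z) \<le> card (b ` Y)"
    using ex_has_greatest_nat [of ?P radical "\<lambda>Y. card (b ` Y)"] quadratic_refinement_radical
    by blast
  interpret Y: subgroup Y A
    using q by (simp add: quadratic_refinement_def)
  have "c \<in> Y" if c: "c \<in> carrier A" for c
  proof -
    define Z where "Z = {z \<in> carrier A. z \<in> Y \<or> z \<otimes> c \<in> Y}"
    have PZ: "?P Z"
      using quadratic_refinement_extend [OF q c] Z_def by blast
    have "c \<otimes> c \<in> Y"
      using q square_in_radical [OF c] by (auto simp: quadratic_refinement_def)
    then have "Y \<subseteq> Z" "c \<in> Z" using c by (auto simp: Z_def)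
    moreover have "finite (b ` Z)"
      using sub [OF PZ] finite_pairing by (meson finite_subset image_mono)
    ultimately have "b c \<in> b ` Y"
      using max [OF PZ] by (metis card_seteq image_eqI image_mono)
    then obtain y where y: "y \<in> Y" "b c = b y" by blast
    then have "c \<otimes> inv y \<in> Y"
      using same_pairing_imp_radical [of c y] c q by (auto simp: quadratic_refinement_def)
    then have "c \<otimes> inv y \<otimes> y \<in> Y" using y by blast
    then show ?thesis using y c by (simp add: m_assoc)
  qed
  then have "Y = carrier A" by auto
  then show ?thesis using q by auto
qed

text \<open>The map \<open>x \<mapsto> x \<otimes> q x\<close> is multiplicative into T: the defect
  of q is exactly the twist, and the twist does not change when its arguments are multiplied by
  radical elements.\<close>

theorem iso_twisted:
  assumes "carrier T = carrier A"
    and "\<And>x y. \<lbrakk>x \<in> carrier A; y \<in> carrier A\<rbrakk> \<Longrightarrow> x \<otimes>\<^bsub>T\<^esub> y = x \<otimes> y \<otimes> b x y"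
  shows "A \<cong> T"
proof -
  obtain q where q: "quadratic_refinement (carrier A) q"
    using quadratic_refinement_exists by blast
  have qR: "\<And>x. x \<in> carrier A \<Longrightarrow> q x \<in> radical" and q1: "\<And>x. x \<in> radical \<Longrightarrow> q x = \<one>"
    and qm: "\<And>x y. x \<in> carrier A \<Longrightarrow> y \<in> carrier A \<Longrightarrow> q (x \<otimes> y) = q x \<otimes> q y \<otimes> b x y"
    using q by (auto simp: quadratic_refinement_def)
  have qc [simp]: "\<And>x. x \<in> carrier A \<Longrightarrow> q x \<in> carrier A"
    using qR radical_closed by blast
  define \<Phi> where "\<Phi> x = x \<otimes> q x" for x
  \<comment> \<open>Constancy of q on cosets of the radical is what makes
    \<open>x \<mapsto> x \<otimes> inv (q x)\<close> a two-sided inverse below.\<close>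
  have q_shift: "q (x \<otimes> r) = q x" if "x \<in> carrier A" "r \<in> radical" for x r
    using that by (simp add: qm radical_closed q1 pairing_radical_right)
  have b_\<Phi>: "b (\<Phi> x) y = b x y" "b y (\<Phi> x) = b y x" if "x \<in> carrier A" "y \<in> carrier A" for x y
    using that qR
    by (simp_all add: \<Phi>_def pairing_mult_left pairing_mult_right pairing_radical_left pairing_radical_right)
  have \<Phi>c: "\<And>x. x \<in> carrier A \<Longrightarrow> \<Phi> x \<in> carrier A" by (simp add: \<Phi>_def)
  have "\<Phi> \<in> hom A T"
  proof (rule homI)
    show "\<Phi> (x \<otimes> y) = \<Phi> x \<otimes>\<^bsub>T\<^esub> \<Phi> y" if "x \<in> carrier A" "y \<in> carrier A" for x y
      using that by (simp add: assms(2) \<Phi>c b_\<Phi>) (simp add: \<Phi>_def qm m_ac)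
  qed (simp add: assms(1) \<Phi>c)
  moreover have "bij_betw \<Phi> (carrier A) (carrier A)"
  proof (rule bij_betwI [where g = "\<lambda>x. x \<otimes> inv (q x)"])
    fix x assume x: "x \<in> carrier A"
    have r: "inv (q x) \<in> radical"
      using subgroup.m_inv_closed [OF subgroup_radical qR [OF x]] .
    show "\<Phi> x \<otimes> inv (q (\<Phi> x)) = x"
      using x qR by (simp add: \<Phi>_def q_shift m_assoc)
    show "\<Phi> (x \<otimes> inv (q x)) = x"
      using x r by (simp add: \<Phi>_def q_shift m_assoc)
  qed (auto simp: \<Phi>c)
  ultimately show ?thesis
    by (auto simp: is_iso_def iso_def assms(1))
qed

end

section \<open>Transfer and finite products of cyclic groups\<close>

text \<open>L is the transfer of \<psi> from S to G. Modulo k it equals the index times \<chi>, so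
  an index congruent to 1 makes it a lift of \<chi> itself. It is used with n = 4 and k = 2.\<close>

lemma (in group) transfer_extension:
  fixes \<psi> \<chi> :: "'a \<Rightarrow> int" and n k :: int
  assumes S: "subgroup S G" and fin: "finite (carrier G)"
    and hom: "\<And>s t. \<lbrakk>s \<in> S; t \<in> S\<rbrakk> \<Longrightarrow> [\<psi> (s \<otimes> t) = \<psi> s + \<psi> t] (mod n)"
    and \<chi>: "\<And>g h. \<lbrakk>g \<in> carrier G; h \<in> carrier G\<rbrakk> \<Longrightarrow> [\<chi> (g \<otimes> h) = \<chi> g + \<chi> h] (mod k)"
    and \<psi>\<chi>: "\<And>s. s \<in> S \<Longrightarrow> [\<psi> s = \<chi> s] (mod k)"
    and index: "[int (card (rcosets S)) = 1] (mod k)"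
  obtains L where "\<And>g h. \<lbrakk>g \<in> carrier G; h \<in> carrier G\<rbrakk> \<Longrightarrow> [L (g \<otimes> h) = L g + L h] (mod n)"
    and "\<And>g. g \<in> carrier G \<Longrightarrow> [L g = \<chi> g] (mod k)"
proof -
  interpret S: subgroup S G by (fact S)
  define rep where "rep C = (SOME x. x \<in> C)" for C :: "'a set"
  \<comment> \<open>Translation by g carries the coset C to \<open>C #> g\<close>, but not
    representative to representative. The correction lies in S:
    \<open>rep C \<otimes> g = s C g \<otimes> rep (C #> g)\<close>.\<close>
  define s where "s C g = rep C \<otimes> g \<otimes> inv (rep (C #> g))" for C g
  define L where "L g = (\<Sum>C\<in>rcosets S. \<psi> (s C g))" for g
  have rep_in: "rep C \<in> C" if "C \<in> rcosets S" for C
    using S.rcosets_non_empty [OF that] by (auto simp: rep_def intro: someI_ex)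
  have rep_carrier: "rep C \<in> carrier G" if "C \<in> rcosets S" for C
    using rep_in [OF that] S.rcosets_carrier [OF is_group that] by blast
  have shift: "C #> g \<in> rcosets S" if "C \<in> rcosets S" "g \<in> carrier G" for C g
    using that S.subset by (auto simp: RCOSETS_def coset_mult_assoc)
  have shift_shift: "C #> g #> h = C #> (g \<otimes> h)"
    if "C \<in> rcosets S" "g \<in> carrier G" "h \<in> carrier G" for C g h
    using that S.rcosets_carrier [OF is_group] by (simp add: coset_mult_assoc)
  \<comment> \<open>Right translation permutes the cosets, which justifies reindexing the sums
    below.\<close>
  have bij: "bij_betw (\<lambda>C. C #> g) (rcosets S) (rcosets S)" if g: "g \<in> carrier G" for g
    by (rule bij_betwI [where g = "\<lambda>C. C #> inv g"])
      (use g shift shift_shift S.rcosets_carrier [OF is_group] in \<open>auto simp: coset_mult_one\<close>)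
  have s_in: "s C g \<in> S" if C: "C \<in> rcosets S" and g: "g \<in> carrier G" for C g
  proof -
    obtain a where a: "a \<in> carrier G" "C #> g = S #> a"
      using shift [OF C g] by (auto simp: RCOSETS_def)
    have "rep C \<otimes> g \<in> S #> a"
      using rep_in [OF C] a(2) by (auto simp: r_coset_def)
    moreover have "rep (C #> g) \<in> S #> a"
      using rep_in [OF shift [OF C g]] a by simp
    ultimately show ?thesis
      unfolding s_def using rep_carrier C g a(1) shift
      by (metis S.rcos_module_imp group.repr_independence is_group S)
  qed
  \<comment> \<open>A cocycle identity for the corrections; summed over all cosets it makes L
    additive modulo n.\<close>
  have s_mult: "s C (g \<otimes> h) = s C g \<otimes> s (C #> g) h"
    if "C \<in> rcosets S" "g \<in> carrier G" "h \<in> carrier G" for C g h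
  proof -
    have cancel: "inv r \<otimes> (r \<otimes> z) = z" if "r \<in> carrier G" "z \<in> carrier G" for r z
      using that by (simp add: m_assoc [symmetric])
    show ?thesis
      using that rep_carrier shift by (simp add: s_def shift_shift m_assoc cancel)
  qed
  have "[L (g \<otimes> h) = L g + L h] (mod n)" if g: "g \<in> carrier G" and h: "h \<in> carrier G" for g h
  proof -
    have "[L (g \<otimes> h) = (\<Sum>C\<in>rcosets S. \<psi> (s C g) + \<psi> (s (C #> g) h))] (mod n)"
      unfolding L_def by (rule cong_sum) (use g h shift s_in hom in \<open>simp add: s_mult\<close>)
    also have "(\<Sum>C\<in>rcosets S. \<psi> (s C g) + \<psi> (s (C #> g) h)) = L g + L h"
      unfolding sum.distrib L_def using sum.reindex_bij_betw [OF bij [OF g], of "\<lambda>C. \<psi> (s C h)"]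
      by simp
    finally show ?thesis .
  qed
  moreover have "[L g = \<chi> g] (mod k)" if g: "g \<in> carrier G" for g
  proof -
    have \<chi>s: "[\<psi> (s C g) = \<chi> (rep C) + \<chi> g - \<chi> (rep (C #> g))] (mod k)" if C: "C \<in> rcosets S" for C
    proof -
      have r: "rep C \<in> carrier G" "rep (C #> g) \<in> carrier G" and sc: "s C g \<in> carrier G"
        using C g rep_carrier shift s_in by auto
      have "rep C \<otimes> g = s C g \<otimes> rep (C #> g)"
        using r g by (simp add: s_def m_assoc)
      then have "[\<chi> (rep C) + \<chi> g = \<chi> (s C g) + \<chi> (rep (C #> g))] (mod k)"
        using \<chi> [OF r(1) g] \<chi> [OF sc r(2)] by (metis cong_sym cong_trans)
      then have "[\<chi> (rep C) + \<chi> g - \<chi> (rep (C #> g)) = \<chi> (s C g)] (mod k)"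
        using cong_diff [OF _ cong_refl [of "\<chi> (rep (C #> g))"]] by fastforce
      then show ?thesis
        using \<psi>\<chi> [OF s_in [OF C g]] by (metis cong_sym cong_trans)
    qed
    have "[L g = (\<Sum>C\<in>rcosets S. \<chi> (rep C) + \<chi> g - \<chi> (rep (C #> g)))] (mod k)"
      unfolding L_def by (rule cong_sum) (rule \<chi>s)
    \<comment> \<open>The representatives occur once with each sign and cancel after reindexing;
      every coset contributes one \<open>\<chi> g\<close>.\<close>
    also have "(\<Sum>C\<in>rcosets S. \<chi> (rep C) + \<chi> g - \<chi> (rep (C #> g))) = int (card (rcosets S)) * \<chi> g"
      using sum.reindex_bij_betw [OF bij [OF g], of "\<lambda>C. \<chi> (rep C)"]
      by (simp add: sum.distrib sum_subtractf)
    also have "[int (card (rcosets S)) * \<chi> g = \<chi> g] (mod k)"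
      using cong_scalar_right [OF index, of "\<chi> g"] by simp
    finally show ?thesis .
  qed
  ultimately show ?thesis by (rule that)
qed

section \<open>Homomorphisms out of products of cyclic groups\<close>

text \<open>The multiple k of the i-th standard generator. Reduction keeps it in the carrier, also
  for a trivial factor, whose generator is 0.\<close>

definition cyclic_unit :: "'i set \<Rightarrow> ('i \<Rightarrow> nat) \<Rightarrow> 'i \<Rightarrow> int \<Rightarrow> 'i \<Rightarrow> int"
  where "cyclic_unit I n i k = (\<lambda>j\<in>I. if j = i then k mod int (n i) else 0)"

lemma cyclic_unit_carrier:
  assumes "\<And>i. i \<in> I \<Longrightarrow> n i > 0"
  shows "cyclic_unit I n i k \<in> carrier (product_group I (\<lambda>i. integer_mod_group (n i)))"
  using assms by (fastforce simp: cyclic_unit_def carrier_integer_mod_group)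

text \<open>x is the sum of the multiples \<open>x i\<close> of the standard generators. Multiples
  of one generator are handled by induction on the multiple, and then the coordinates are added one
  at a time.\<close>

lemma product_cyclic_hom_expansion:
  fixes \<chi> :: "('i \<Rightarrow> int) \<Rightarrow> int"
  assumes fin: "finite I" and n: "\<And>i. i \<in> I \<Longrightarrow> n i > 0"
    and P: "P = product_group I (\<lambda>i. integer_mod_group (n i))"
    and \<chi>: "\<And>x y. \<lbrakk>x \<in> carrier P; y \<in> carrier P\<rbrakk> \<Longrightarrow> [\<chi> (x \<otimes>\<^bsub>P\<^esub> y) = \<chi> x + \<chi> y] (mod m)"
    and x: "x \<in> carrier P"
  shows "[\<chi> x = (\<Sum>i\<in>I. \<chi> (cyclic_unit I n i 1) * x i)] (mod m)"
proof -
  let ?u = "cyclic_unit I n"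
  have uP: "?u i k \<in> carrier P" for i k
    using cyclic_unit_carrier [of I n] n P by blast
  have zero: "[\<chi> (\<lambda>j\<in>I. 0) = 0] (mod m)"
  proof -
    have e: "(\<lambda>j\<in>I. 0) \<in> carrier P" by (auto simp: P)
    have "[\<chi> (\<lambda>j\<in>I. 0) + 0 = \<chi> (\<lambda>j\<in>I. 0) + \<chi> (\<lambda>j\<in>I. 0)] (mod m)"
      using \<chi> [OF e e] by (simp add: P cong: restrict_cong)
    then show ?thesis
      unfolding cong_add_lcancel by (rule cong_sym)
  qed
  have unit: "[\<chi> (?u i (int k)) = \<chi> (?u i 1) * int k] (mod m)" for i k
  proof (induction k)
    case 0
    have "?u i 0 = (\<lambda>j\<in>I. 0)" by (auto simp: cyclic_unit_def)
    then show ?case using zero by (simp only: of_nat_0 mult_zero_right)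
  next
    case (Suc k)
    have "?u i (int (Suc k)) = ?u i (int k) \<otimes>\<^bsub>P\<^esub> ?u i 1"
      by (auto simp: cyclic_unit_def P mod_add_eq add.commute)
    then have "[\<chi> (?u i (int (Suc k))) = \<chi> (?u i (int k)) + \<chi> (?u i 1)] (mod m)"
      using \<chi> [OF uP uP] by simp
    also have "[\<chi> (?u i (int k)) + \<chi> (?u i 1) = \<chi> (?u i 1) * int k + \<chi> (?u i 1)] (mod m)"
      using Suc by (intro cong_add) auto
    finally show ?case by (simp add: algebra_simps)
  qed
  have range: "0 \<le> x i" "x i < int (n i)" if "i \<in> I" for i
    using x that n [OF that] by (auto simp: P carrier_integer_mod_group PiE_iff)
  \<comment> \<open>Induction over the truncations of x to the coordinates in J. A coordinate is a
    residue between 0 and the modulus, hence a natural multiple of its generator.\<close>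
  have "[\<chi> (\<lambda>j\<in>I. if j \<in> J then x j else 0) = (\<Sum>i\<in>J. \<chi> (?u i 1) * x i)] (mod m)" if "J \<subseteq> I" for J
    using finite_subset [OF that fin] that
  proof (induction J rule: finite_induct)
    case empty
    show ?case using zero by (simp only: empty_iff if_False sum.empty)
  next
    case (insert i J)
    let ?y = "\<lambda>j\<in>I. if j \<in> J then x j else 0"
    have y: "?y \<in> carrier P"
      using range n by (auto simp: P carrier_integer_mod_group)
    have "(\<lambda>j\<in>I. if j \<in> insert i J then x j else 0) = ?u i (int (nat (x i))) \<otimes>\<^bsub>P\<^esub> ?y"
      using insert.hyps insert.prems range by (auto simp: cyclic_unit_def P fun_eq_iff)
    then have "[\<chi> (\<lambda>j\<in>I. if j \<in> insert i J then x j else 0) = \<chi> (?u i (int (nat (x i)))) + \<chi> ?y] (mod m)"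
      using \<chi> [OF uP y] by simp
    also have "[\<chi> (?u i (int (nat (x i)))) + \<chi> ?y = \<chi> (?u i 1) * int (nat (x i)) + (\<Sum>i\<in>J. \<chi> (?u i 1) * x i)] (mod m)"
      using insert.prems by (intro cong_add [OF unit insert.IH]) blast
    also have "\<chi> (?u i 1) * int (nat (x i)) + (\<Sum>i\<in>J. \<chi> (?u i 1) * x i)
        = (\<Sum>i\<in>insert i J. \<chi> (?u i 1) * x i)"
      using insert.hyps insert.prems range by simp
    finally show ?case .
  qed
  from this [OF subset_refl] have "[\<chi> (\<lambda>j\<in>I. if j \<in> I then x j else 0) = (\<Sum>i\<in>I. \<chi> (?u i 1) * x i)] (mod m)" .
  moreover have "(\<lambda>j\<in>I. if j \<in> I then x j else 0) = x"
    using x by (auto simp: P PiE_iff extensional_def)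
  ultimately show ?thesis by simp
qed

text \<open>Multiplication by c is well defined from the integers modulo \<open>2 ^ e\<close> to the
  integers modulo 4 for every c as soon as e is at least 2. For e = 1 the coefficient 0 serves,
  since \<chi> is even on that generator, and for e = 0 the coordinate vanishes.\<close>

lemma product_cyclic_lift_mod_4:
  fixes \<chi> :: "('i \<Rightarrow> int) \<Rightarrow> int" and e :: "'i \<Rightarrow> nat"
  assumes fin: "finite I"
    and P: "P = product_group I (\<lambda>i. integer_mod_group (2 ^ e i))"
    and \<chi>: "\<And>x y. \<lbrakk>x \<in> carrier P; y \<in> carrier P\<rbrakk> \<Longrightarrow> [\<chi> (x \<otimes>\<^bsub>P\<^esub> y) = \<chi> x + \<chi> y] (mod 2)"
    and even: "\<And>i. \<lbrakk>i \<in> I; e i = 1\<rbrakk> \<Longrightarrow> even (\<chi> (cyclic_unit I (\<lambda>i. 2 ^ e i) i 1))"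
  obtains \<psi> where "\<And>x y. \<lbrakk>x \<in> carrier P; y \<in> carrier P\<rbrakk> \<Longrightarrow> [\<psi> (x \<otimes>\<^bsub>P\<^esub> y) = \<psi> x + \<psi> y] (mod 4)"
    and "\<And>x. x \<in> carrier P \<Longrightarrow> [\<psi> x = \<chi> x] (mod 2)"
proof -
  define c where "c i = (if e i = 1 then 0 else \<chi> (cyclic_unit I (\<lambda>i. 2 ^ e i) i 1))" for i
  define \<psi> where "\<psi> x = (\<Sum>i\<in>I. c i * x i)" for x
  have "[\<psi> (x \<otimes>\<^bsub>P\<^esub> y) = \<psi> x + \<psi> y] (mod 4)" if xy: "x \<in> carrier P" "y \<in> carrier P" for x y
  proof -
    have "[c i * (x \<otimes>\<^bsub>P\<^esub> y) i = c i * x i + c i * y i] (mod 4)" if i: "i \<in> I" for i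
    proof -
      consider "e i = 0" | "e i = 1" | "e i \<ge> 2" by linarith
      then show ?thesis
      proof cases
        case 1
        then have "x i = 0" "y i = 0"
          using xy i by (auto simp: P PiE_iff carrier_integer_mod_group)
        then show ?thesis using i by (simp add: P)
      next
        case 2
        then show ?thesis by (simp add: c_def)
      next
        case 3
        then have "(2::int) ^ 2 dvd 2 ^ e i" by (rule le_imp_power_dvd)
        then have "[(x i + y i) mod 2 ^ e i = x i + y i] (mod 4)"
          by (simp add: cong_def mod_mod_cancel)
        then show ?thesis
          using i cong_scalar_left [of _ _ 4 "c i"] by (simp add: P distrib_left [symmetric])
      qed
    qed
    then show ?thesis
      unfolding \<psi>_def sum.distrib [symmetric] by (rule cong_sum)
  qed
  moreover have "[\<psi> x = \<chi> x] (mod 2)" if x: "x \<in> carrier P" for x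
  proof -
    have "[\<psi> x = (\<Sum>i\<in>I. \<chi> (cyclic_unit I (\<lambda>i. 2 ^ e i) i 1) * x i)] (mod 2)"
      unfolding \<psi>_def
    proof (rule cong_sum)
      show "[c i * x i = \<chi> (cyclic_unit I (\<lambda>i. 2 ^ e i) i 1) * x i] (mod 2)" if "i \<in> I" for i
        using even [OF that] by (auto simp: c_def cong_def mod_eq_0_iff_dvd)
    qed
    moreover have "[\<chi> x = (\<Sum>i\<in>I. \<chi> (cyclic_unit I (\<lambda>i. 2 ^ e i) i 1) * x i)] (mod 2)"
      by (rule product_cyclic_hom_expansion [OF fin _ P \<chi> x]) simp_all
    ultimately show ?thesis by (metis cong_sym cong_trans)
  qed
  ultimately show ?thesis by (rule that)
qed

section \<open>Normalized cocycles and the pairing theta\<close>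

lemma twococyclesD:
  assumes "\<sigma> \<in> twococycles G A"
  shows "g \<in> carrier G \<Longrightarrow> h \<in> carrier G \<Longrightarrow> \<sigma> (g, h) \<in> carrier A"
    and "g \<in> carrier G \<Longrightarrow> \<sigma> (g, \<one>\<^bsub>G\<^esub>) = \<one>\<^bsub>A\<^esub>"
    and "g \<in> carrier G \<Longrightarrow> \<sigma> (\<one>\<^bsub>G\<^esub>, g) = \<one>\<^bsub>A\<^esub>"
    and "\<lbrakk>g \<in> carrier G; h \<in> carrier G; l \<in> carrier G\<rbrakk> \<Longrightarrow>
      \<sigma> (g, h) \<otimes>\<^bsub>A\<^esub> \<sigma> (g \<otimes>\<^bsub>G\<^esub> h, l) = \<sigma> (h, l) \<otimes>\<^bsub>A\<^esub> \<sigma> (g, h \<otimes>\<^bsub>G\<^esub> l)"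
    and "\<sigma> \<in> extensional (carrier G \<times> carrier G)"
  using assms by (auto simp: twococycles_def PiE_iff)

locale trivial_module = G: group G + A: comm_group A
  for G :: "('a, 'm) monoid_scheme" and A :: "('b, 'n) monoid_scheme"
begin

lemma twococyclesI:
  assumes "\<And>g h. g \<in> carrier G \<Longrightarrow> h \<in> carrier G \<Longrightarrow> f (g, h) \<in> carrier A"
    and "\<And>g. g \<in> carrier G \<Longrightarrow> f (g, \<one>\<^bsub>G\<^esub>) = \<one>\<^bsub>A\<^esub>"
    and "\<And>g. g \<in> carrier G \<Longrightarrow> f (\<one>\<^bsub>G\<^esub>, g) = \<one>\<^bsub>A\<^esub>"
    and "\<And>g h l. \<lbrakk>g \<in> carrier G; h \<in> carrier G; l \<in> carrier G\<rbrakk> \<Longrightarrow>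
      f (g, h) \<otimes>\<^bsub>A\<^esub> f (g \<otimes>\<^bsub>G\<^esub> h, l) = f (h, l) \<otimes>\<^bsub>A\<^esub> f (g, h \<otimes>\<^bsub>G\<^esub> l)"
  shows "restrict f (carrier G \<times> carrier G) \<in> twococycles G A"
  using assms by (auto simp: twococycles_def)

section \<open>The groups of cocycles and coboundaries\<close>

lemma carrier_Z2 [simp]: "carrier (Z2 G A) = twococycles G A"
  and one_Z2 [simp]: "\<one>\<^bsub>Z2 G A\<^esub> = (\<lambda>_\<in>carrier G \<times> carrier G. \<one>\<^bsub>A\<^esub>)"
  and mult_Z2: "\<sigma> \<otimes>\<^bsub>Z2 G A\<^esub> \<tau> = (\<lambda>x\<in>carrier G \<times> carrier G. \<sigma> x \<otimes>\<^bsub>A\<^esub> \<tau> x)"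
  by (simp_all add: Z2_def)

lemma mult_Z2_apply [simp]:
  "\<lbrakk>g \<in> carrier G; h \<in> carrier G\<rbrakk> \<Longrightarrow> (\<sigma> \<otimes>\<^bsub>Z2 G A\<^esub> \<tau>) (g, h) = \<sigma> (g, h) \<otimes>\<^bsub>A\<^esub> \<tau> (g, h)"
  by (simp add: mult_Z2)

lemma twococycle_eqI:
  assumes "\<sigma> \<in> extensional (carrier G \<times> carrier G)" "\<tau> \<in> extensional (carrier G \<times> carrier G)"
    and "\<And>g h. \<lbrakk>g \<in> carrier G; h \<in> carrier G\<rbrakk> \<Longrightarrow> \<sigma> (g, h) = \<tau> (g, h)"
  shows "\<sigma> = \<tau>"
  using assms by (intro extensionalityI [of \<sigma> "carrier G \<times> carrier G" \<tau>]) auto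

lemma inv_cocycle:
  assumes \<sigma>: "\<sigma> \<in> twococycles G A"
  shows "(\<lambda>x\<in>carrier G \<times> carrier G. inv\<^bsub>A\<^esub> \<sigma> x) \<in> twococycles G A"
  by (rule twococyclesI)
    (simp_all add: twococyclesD [OF \<sigma>] A.inv_mult [symmetric] A.inv_mult_group [symmetric]
      del: A.inv_mult_group)

lemma comm_group_Z2: "comm_group (Z2 G A)"
proof (rule comm_groupI)
  fix x y z
  assume x: "x \<in> carrier (Z2 G A)" and y: "y \<in> carrier (Z2 G A)"
  then have x': "x \<in> twococycles G A" and y': "y \<in> twococycles G A" by simp_all
  note xD = twococyclesD [OF x'] and yD = twococyclesD [OF y']
  show "x \<otimes>\<^bsub>Z2 G A\<^esub> y \<in> carrier (Z2 G A)"
    unfolding mult_Z2 carrier_Z2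
  proof (rule twococyclesI)
    fix g h l assume g: "g \<in> carrier G" "h \<in> carrier G" "l \<in> carrier G"
    have "x (g, h) \<otimes>\<^bsub>A\<^esub> y (g, h) \<otimes>\<^bsub>A\<^esub> (x (g \<otimes>\<^bsub>G\<^esub> h, l) \<otimes>\<^bsub>A\<^esub> y (g \<otimes>\<^bsub>G\<^esub> h, l))
      = (x (g, h) \<otimes>\<^bsub>A\<^esub> x (g \<otimes>\<^bsub>G\<^esub> h, l)) \<otimes>\<^bsub>A\<^esub> (y (g, h) \<otimes>\<^bsub>A\<^esub> y (g \<otimes>\<^bsub>G\<^esub> h, l))"
      using g xD(1) yD(1) by (simp add: A.m_ac)
    also have "\<dots> = x (h, l) \<otimes>\<^bsub>A\<^esub> y (h, l) \<otimes>\<^bsub>A\<^esub> (x (g, h \<otimes>\<^bsub>G\<^esub> l) \<otimes>\<^bsub>A\<^esub> y (g, h \<otimes>\<^bsub>G\<^esub> l))"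
      unfolding xD(4) [OF g] yD(4) [OF g] using g xD(1) yD(1) by (simp add: A.m_ac)
    finally show "x (g, h) \<otimes>\<^bsub>A\<^esub> y (g, h) \<otimes>\<^bsub>A\<^esub> (x (g \<otimes>\<^bsub>G\<^esub> h, l) \<otimes>\<^bsub>A\<^esub> y (g \<otimes>\<^bsub>G\<^esub> h, l))
      = x (h, l) \<otimes>\<^bsub>A\<^esub> y (h, l) \<otimes>\<^bsub>A\<^esub> (x (g, h \<otimes>\<^bsub>G\<^esub> l) \<otimes>\<^bsub>A\<^esub> y (g, h \<otimes>\<^bsub>G\<^esub> l))" .
  qed (simp_all add: xD yD)
  show "x \<otimes>\<^bsub>Z2 G A\<^esub> y = y \<otimes>\<^bsub>Z2 G A\<^esub> x"
    by (rule twococycle_eqI) (simp_all add: mult_Z2 xD yD A.m_comm)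
  show "\<one>\<^bsub>Z2 G A\<^esub> \<otimes>\<^bsub>Z2 G A\<^esub> x = x"
    by (rule twococycle_eqI) (simp_all add: mult_Z2 xD)
  show "\<exists>y\<in>carrier (Z2 G A). y \<otimes>\<^bsub>Z2 G A\<^esub> x = \<one>\<^bsub>Z2 G A\<^esub>"
  proof
    show "(\<lambda>x'\<in>carrier G \<times> carrier G. inv\<^bsub>A\<^esub> x x') \<otimes>\<^bsub>Z2 G A\<^esub> x = \<one>\<^bsub>Z2 G A\<^esub>"
      by (rule twococycle_eqI) (simp_all add: mult_Z2 xD)
  qed (simp add: inv_cocycle [OF x'])
  assume "z \<in> carrier (Z2 G A)"
  then have "z \<in> twococycles G A" by simp
  note zD = twococyclesD [OF this]
  show "x \<otimes>\<^bsub>Z2 G A\<^esub> y \<otimes>\<^bsub>Z2 G A\<^esub> z = x \<otimes>\<^bsub>Z2 G A\<^esub> (y \<otimes>\<^bsub>Z2 G A\<^esub> z)"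
    by (rule twococycle_eqI) (simp_all add: mult_Z2 xD yD zD A.m_assoc)
next
  show "\<one>\<^bsub>Z2 G A\<^esub> \<in> carrier (Z2 G A)"
    unfolding one_Z2 carrier_Z2 by (rule twococyclesI) simp_all
qed

sublocale Z2: comm_group "Z2 G A"
  by (rule comm_group_Z2)

lemma inv_Z2_apply:
  assumes "\<sigma> \<in> twococycles G A" "g \<in> carrier G" "h \<in> carrier G"
  shows "(inv\<^bsub>Z2 G A\<^esub> \<sigma>) (g, h) = inv\<^bsub>A\<^esub> \<sigma> (g, h)"
proof -
  have "(\<lambda>x\<in>carrier G \<times> carrier G. inv\<^bsub>A\<^esub> \<sigma> x) \<otimes>\<^bsub>Z2 G A\<^esub> \<sigma> = \<one>\<^bsub>Z2 G A\<^esub>"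
    by (rule twococycle_eqI) (simp_all add: mult_Z2 twococyclesD [OF assms(1)])
  then have "inv\<^bsub>Z2 G A\<^esub> \<sigma> = (\<lambda>x\<in>carrier G \<times> carrier G. inv\<^bsub>A\<^esub> \<sigma> x)"
    using inv_cocycle assms(1) by (intro Z2.inv_equality) simp_all
  then show ?thesis using assms(2,3) by simp
qed

text \<open>A division-free form of the coboundary condition, in which explicit cochains \<gamma>
  are easier to check.\<close>

lemma twocoboundaries_iff:
  "\<sigma> \<in> twocoboundaries G A \<longleftrightarrow> \<sigma> \<in> extensional (carrier G \<times> carrier G) \<and>
    (\<exists>\<gamma>\<in>carrier G \<rightarrow> carrier A. \<gamma> \<one>\<^bsub>G\<^esub> = \<one>\<^bsub>A\<^esub> \<and>
      (\<forall>g\<in>carrier G. \<forall>h\<in>carrier G. \<gamma> g \<otimes>\<^bsub>A\<^esub> \<gamma> h = \<sigma> (g, h) \<otimes>\<^bsub>A\<^esub> \<gamma> (g \<otimes>\<^bsub>G\<^esub> h) \<and> \<sigma> (g, h) \<in> carrier A))"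
    (is "_ \<longleftrightarrow> ?R")
proof
  assume "\<sigma> \<in> twocoboundaries G A"
  then obtain \<gamma> where \<gamma>: "\<gamma> \<in> carrier G \<rightarrow> carrier A" "\<gamma> \<one>\<^bsub>G\<^esub> = \<one>\<^bsub>A\<^esub>" "\<sigma> = coboundary G A \<gamma>"
    by (auto simp: twocoboundaries_def)
  then have "\<And>g. g \<in> carrier G \<Longrightarrow> \<gamma> g \<in> carrier A" by auto
  then show ?R
    using \<gamma> by (auto simp: coboundary_def A.m_assoc intro!: bexI [of _ \<gamma>])
next
  assume R: ?R
  then obtain \<gamma> where \<gamma>: "\<gamma> \<in> carrier G \<rightarrow> carrier A" "\<gamma> \<one>\<^bsub>G\<^esub> = \<one>\<^bsub>A\<^esub>"
    and eq: "\<And>g h. g \<in> carrier G \<Longrightarrow> h \<in> carrier G \<Longrightarrow>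
      \<gamma> g \<otimes>\<^bsub>A\<^esub> \<gamma> h = \<sigma> (g, h) \<otimes>\<^bsub>A\<^esub> \<gamma> (g \<otimes>\<^bsub>G\<^esub> h) \<and> \<sigma> (g, h) \<in> carrier A"
    by blast
  have \<gamma>c: "\<And>g. g \<in> carrier G \<Longrightarrow> \<gamma> g \<in> carrier A" using \<gamma> by auto
  have "\<sigma> = coboundary G A \<gamma>"
    by (rule twococycle_eqI) (use R \<gamma>c eq in \<open>auto simp: coboundary_def A.m_assoc\<close>)
  then show "\<sigma> \<in> twocoboundaries G A" using \<gamma> by (auto simp: twocoboundaries_def)
qed

lemma coboundary_cocycle: 
  assumes "\<sigma> \<in> twocoboundaries G A"
  shows "\<sigma> \<in> twococycles G A"
proof -
  obtain \<gamma> where \<gamma>: "\<gamma> \<in> carrier G \<rightarrow> carrier A" and \<gamma>1: "\<gamma> \<one>\<^bsub>G\<^esub> = \<one>\<^bsub>A\<^esub>"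
    and \<sigma>: "\<sigma> = coboundary G A \<gamma>"
    using assms by (auto simp: twocoboundaries_def)
  have \<gamma>c: "\<And>g. g \<in> carrier G \<Longrightarrow> \<gamma> g \<in> carrier A" using \<gamma> by auto
  have cancel: "inv\<^bsub>A\<^esub> a \<otimes>\<^bsub>A\<^esub> (a \<otimes>\<^bsub>A\<^esub> c) = c" "a \<otimes>\<^bsub>A\<^esub> (inv\<^bsub>A\<^esub> a \<otimes>\<^bsub>A\<^esub> c) = c"
    if "a \<in> carrier A" "c \<in> carrier A" for a c
    using that by (simp_all add: A.m_assoc [symmetric])
  show ?thesis
    unfolding \<sigma> coboundary_def
  proof (rule twococyclesI, unfold prod.case)
    fix g h l assume g: "g \<in> carrier G" "h \<in> carrier G" "l \<in> carrier G"
    define p q r s t w where "p = \<gamma> g" "q = \<gamma> h" "r = \<gamma> l" "s = \<gamma> (g \<otimes>\<^bsub>G\<^esub> h)" "t = \<gamma> (h \<otimes>\<^bsub>G\<^esub> l)"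
      "w = \<gamma> (g \<otimes>\<^bsub>G\<^esub> h \<otimes>\<^bsub>G\<^esub> l)"
    have c: "p \<in> carrier A" "q \<in> carrier A" "r \<in> carrier A" "s \<in> carrier A" "t \<in> carrier A" "w \<in> carrier A"
      using g \<gamma>c by (simp_all add: p_q_r_s_t_w_def)
    have w': "\<gamma> (g \<otimes>\<^bsub>G\<^esub> (h \<otimes>\<^bsub>G\<^esub> l)) = w"
      using g by (simp add: p_q_r_s_t_w_def G.m_assoc)
    \<comment> \<open>Both sides of the cocycle identity reduce to the product of \<gamma> at g, h
      and l, divided by its value at the triple product.\<close>
    have "p \<otimes>\<^bsub>A\<^esub> q \<otimes>\<^bsub>A\<^esub> inv\<^bsub>A\<^esub> s \<otimes>\<^bsub>A\<^esub> (s \<otimes>\<^bsub>A\<^esub> r \<otimes>\<^bsub>A\<^esub> inv\<^bsub>A\<^esub> w) = p \<otimes>\<^bsub>A\<^esub> q \<otimes>\<^bsub>A\<^esub> r \<otimes>\<^bsub>A\<^esub> inv\<^bsub>A\<^esub> w"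
      using c by (simp add: A.m_assoc cancel)
    also have "\<dots> = q \<otimes>\<^bsub>A\<^esub> r \<otimes>\<^bsub>A\<^esub> inv\<^bsub>A\<^esub> t \<otimes>\<^bsub>A\<^esub> (t \<otimes>\<^bsub>A\<^esub> p \<otimes>\<^bsub>A\<^esub> inv\<^bsub>A\<^esub> w)"
      using c by (simp add: A.m_assoc cancel) (simp add: A.m_ac)
    also have "t \<otimes>\<^bsub>A\<^esub> p = p \<otimes>\<^bsub>A\<^esub> t"
      using c by (simp add: A.m_comm)
    finally show "\<gamma> g \<otimes>\<^bsub>A\<^esub> \<gamma> h \<otimes>\<^bsub>A\<^esub> inv\<^bsub>A\<^esub> \<gamma> (g \<otimes>\<^bsub>G\<^esub> h) \<otimes>\<^bsub>A\<^esub>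
        (\<gamma> (g \<otimes>\<^bsub>G\<^esub> h) \<otimes>\<^bsub>A\<^esub> \<gamma> l \<otimes>\<^bsub>A\<^esub> inv\<^bsub>A\<^esub> \<gamma> (g \<otimes>\<^bsub>G\<^esub> h \<otimes>\<^bsub>G\<^esub> l)) =
      \<gamma> h \<otimes>\<^bsub>A\<^esub> \<gamma> l \<otimes>\<^bsub>A\<^esub> inv\<^bsub>A\<^esub> \<gamma> (h \<otimes>\<^bsub>G\<^esub> l) \<otimes>\<^bsub>A\<^esub>
        (\<gamma> g \<otimes>\<^bsub>A\<^esub> \<gamma> (h \<otimes>\<^bsub>G\<^esub> l) \<otimes>\<^bsub>A\<^esub> inv\<^bsub>A\<^esub> \<gamma> (g \<otimes>\<^bsub>G\<^esub> (h \<otimes>\<^bsub>G\<^esub> l)))"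
      unfolding w' unfolding p_q_r_s_t_w_def .
  qed (simp_all add: \<gamma>c \<gamma>1)
qed

lemma subgroup_twocoboundaries: "subgroup (twocoboundaries G A) (Z2 G A)"
proof
  show "twocoboundaries G A \<subseteq> carrier (Z2 G A)" using coboundary_cocycle by auto
  show "\<one>\<^bsub>Z2 G A\<^esub> \<in> twocoboundaries G A"
    unfolding twocoboundaries_iff by (auto intro!: bexI [of _ "\<lambda>_. \<one>\<^bsub>A\<^esub>"])
next
  fix \<sigma> \<tau> assume \<sigma>: "\<sigma> \<in> twocoboundaries G A" and \<tau>: "\<tau> \<in> twocoboundaries G A"
  obtain \<gamma> where \<gamma>: "\<gamma> \<in> carrier G \<rightarrow> carrier A" "\<gamma> \<one>\<^bsub>G\<^esub> = \<one>\<^bsub>A\<^esub>"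
    and eq: "\<And>g h. g \<in> carrier G \<Longrightarrow> h \<in> carrier G \<Longrightarrow>
      \<gamma> g \<otimes>\<^bsub>A\<^esub> \<gamma> h = \<sigma> (g, h) \<otimes>\<^bsub>A\<^esub> \<gamma> (g \<otimes>\<^bsub>G\<^esub> h) \<and> \<sigma> (g, h) \<in> carrier A"
    using \<sigma> unfolding twocoboundaries_iff by blast
  obtain \<delta> where \<delta>: "\<delta> \<in> carrier G \<rightarrow> carrier A" "\<delta> \<one>\<^bsub>G\<^esub> = \<one>\<^bsub>A\<^esub>"
    and eq': "\<And>g h. g \<in> carrier G \<Longrightarrow> h \<in> carrier G \<Longrightarrow>
      \<delta> g \<otimes>\<^bsub>A\<^esub> \<delta> h = \<tau> (g, h) \<otimes>\<^bsub>A\<^esub> \<delta> (g \<otimes>\<^bsub>G\<^esub> h) \<and> \<tau> (g, h) \<in> carrier A"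
    using \<tau> unfolding twocoboundaries_iff by blast
  have c: "\<And>g. g \<in> carrier G \<Longrightarrow> \<gamma> g \<in> carrier A" "\<And>g. g \<in> carrier G \<Longrightarrow> \<delta> g \<in> carrier A"
    using \<gamma> \<delta> by auto
  have "(\<gamma> g \<otimes>\<^bsub>A\<^esub> \<delta> g) \<otimes>\<^bsub>A\<^esub> (\<gamma> h \<otimes>\<^bsub>A\<^esub> \<delta> h) =
      (\<sigma> (g, h) \<otimes>\<^bsub>A\<^esub> \<tau> (g, h)) \<otimes>\<^bsub>A\<^esub> (\<gamma> (g \<otimes>\<^bsub>G\<^esub> h) \<otimes>\<^bsub>A\<^esub> \<delta> (g \<otimes>\<^bsub>G\<^esub> h))"
    if g: "g \<in> carrier G" "h \<in> carrier G" for g h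
  proof -
    have "(\<gamma> g \<otimes>\<^bsub>A\<^esub> \<delta> g) \<otimes>\<^bsub>A\<^esub> (\<gamma> h \<otimes>\<^bsub>A\<^esub> \<delta> h) = (\<gamma> g \<otimes>\<^bsub>A\<^esub> \<gamma> h) \<otimes>\<^bsub>A\<^esub> (\<delta> g \<otimes>\<^bsub>A\<^esub> \<delta> h)"
      using g c by (simp add: A.m_ac)
    also have "\<dots> = (\<sigma> (g, h) \<otimes>\<^bsub>A\<^esub> \<gamma> (g \<otimes>\<^bsub>G\<^esub> h)) \<otimes>\<^bsub>A\<^esub> (\<tau> (g, h) \<otimes>\<^bsub>A\<^esub> \<delta> (g \<otimes>\<^bsub>G\<^esub> h))"
      using g eq eq' by simp
    also have "\<dots> = (\<sigma> (g, h) \<otimes>\<^bsub>A\<^esub> \<tau> (g, h)) \<otimes>\<^bsub>A\<^esub> (\<gamma> (g \<otimes>\<^bsub>G\<^esub> h) \<otimes>\<^bsub>A\<^esub> \<delta> (g \<otimes>\<^bsub>G\<^esub> h))"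
      using g c eq eq' by (simp add: A.m_ac)
    finally show ?thesis .
  qed
  then show "\<sigma> \<otimes>\<^bsub>Z2 G A\<^esub> \<tau> \<in> twocoboundaries G A"
    unfolding twocoboundaries_iff using \<gamma> \<delta> c eq eq'
    by (auto simp: mult_Z2 intro!: bexI [of _ "\<lambda>g. \<gamma> g \<otimes>\<^bsub>A\<^esub> \<delta> g"])
next
  fix \<sigma> assume \<sigma>: "\<sigma> \<in> twocoboundaries G A"
  have \<sigma>c: "\<sigma> \<in> twococycles G A" using coboundary_cocycle [OF \<sigma>] .
  obtain \<gamma> where \<gamma>: "\<gamma> \<in> carrier G \<rightarrow> carrier A" "\<gamma> \<one>\<^bsub>G\<^esub> = \<one>\<^bsub>A\<^esub>"
    and eq: "\<And>g h. g \<in> carrier G \<Longrightarrow> h \<in> carrier G \<Longrightarrow>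
      \<gamma> g \<otimes>\<^bsub>A\<^esub> \<gamma> h = \<sigma> (g, h) \<otimes>\<^bsub>A\<^esub> \<gamma> (g \<otimes>\<^bsub>G\<^esub> h) \<and> \<sigma> (g, h) \<in> carrier A"
    using \<sigma> unfolding twocoboundaries_iff by blast
  have c: "\<And>g. g \<in> carrier G \<Longrightarrow> \<gamma> g \<in> carrier A" using \<gamma> by auto
  have "inv\<^bsub>A\<^esub> (\<gamma> g) \<otimes>\<^bsub>A\<^esub> inv\<^bsub>A\<^esub> (\<gamma> h) = inv\<^bsub>A\<^esub> (\<sigma> (g, h)) \<otimes>\<^bsub>A\<^esub> inv\<^bsub>A\<^esub> (\<gamma> (g \<otimes>\<^bsub>G\<^esub> h))"
    if g: "g \<in> carrier G" "h \<in> carrier G" for g h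
    using g c eq [OF g] by (metis A.inv_mult G.m_closed)
  moreover have "inv\<^bsub>Z2 G A\<^esub> \<sigma> \<in> extensional (carrier G \<times> carrier G)"
    using Z2.inv_closed [of \<sigma>] \<sigma>c by (simp add: twococyclesD(5))
  ultimately show "inv\<^bsub>Z2 G A\<^esub> \<sigma> \<in> twocoboundaries G A"
    unfolding twocoboundaries_iff using \<gamma> c eq
    by (auto simp: inv_Z2_apply [OF \<sigma>c] intro!: bexI [of _ "\<lambda>g. inv\<^bsub>A\<^esub> (\<gamma> g)"])
qed

sublocale B2: normal "twocoboundaries G A" "Z2 G A"
  using Z2.subgroup_imp_normal [OF subgroup_twocoboundaries] .

sublocale H2: comm_group "H2 G A"
  unfolding H2_def by (rule Z2.abelian_FactGroup [OF subgroup_twocoboundaries])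

section \<open>Multiplicativity of theta on commuting pairs\<close>

lemma theta_closed:
  "\<lbrakk>\<sigma> \<in> twococycles G A; g \<in> carrier G; h \<in> carrier G\<rbrakk> \<Longrightarrow> theta A \<sigma> g h \<in> carrier A"
  by (simp add: theta_def twococyclesD)

lemma theta_self: "\<lbrakk>\<sigma> \<in> twococycles G A; g \<in> carrier G\<rbrakk> \<Longrightarrow> theta A \<sigma> g g = \<one>\<^bsub>A\<^esub>"
  by (simp add: theta_def twococyclesD)

lemma theta_one: "\<lbrakk>\<sigma> \<in> twococycles G A; g \<in> carrier G\<rbrakk> \<Longrightarrow> theta A \<sigma> g \<one>\<^bsub>G\<^esub> = \<one>\<^bsub>A\<^esub>"
  by (simp add: theta_def twococyclesD)

lemma theta_swap:
  "\<lbrakk>\<sigma> \<in> twococycles G A; g \<in> carrier G; h \<in> carrier G\<rbrakk> \<Longrightarrow> theta A \<sigma> h g = inv\<^bsub>A\<^esub> theta A \<sigma> g h"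
  by (simp add: theta_def twococyclesD A.inv_mult A.m_comm)

lemma theta_mult_cocycle:
  "\<lbrakk>\<sigma> \<in> twococycles G A; \<tau> \<in> twococycles G A; g \<in> carrier G; h \<in> carrier G\<rbrakk> \<Longrightarrow>
    theta A (\<sigma> \<otimes>\<^bsub>Z2 G A\<^esub> \<tau>) g h = theta A \<sigma> g h \<otimes>\<^bsub>A\<^esub> theta A \<tau> g h"
  by (simp add: theta_def twococyclesD A.inv_mult A.m_ac)

text \<open>A coboundary is symmetric on commuting pairs.\<close>

lemma theta_coboundary:
  assumes \<sigma>: "\<sigma> \<in> twocoboundaries G A" and g: "g \<in> carrier G" "h \<in> carrier G"
    and "g \<otimes>\<^bsub>G\<^esub> h = h \<otimes>\<^bsub>G\<^esub> g"
  shows "theta A \<sigma> g h = \<one>\<^bsub>A\<^esub>"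
proof -
  obtain \<gamma> where "\<gamma> \<in> carrier G \<rightarrow> carrier A" "\<sigma> = coboundary G A \<gamma>"
    using \<sigma> by (auto simp: twocoboundaries_def)
  then have "\<sigma> (g, h) = \<sigma> (h, g)"
    using assms by (auto simp: coboundary_def Pi_iff A.m_comm)
  then show ?thesis
    using twococyclesD(1) [OF coboundary_cocycle [OF \<sigma>]] g by (simp add: theta_def)
qed

text \<open>The cocycle identity is used at the triples \<open>(g, h, v)\<close>,
  \<open>(v, g, h)\<close> and \<open>(g, v, h)\<close>. The commutation of v with g and with h
  identifies the mixed terms, so that everything apart from the values of theta cancels.\<close>

lemma theta_mult_left:
  assumes \<sigma>: "\<sigma> \<in> twococycles G A" and g: "g \<in> carrier G" "h \<in> carrier G" "v \<in> carrier G"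
    and comm: "g \<otimes>\<^bsub>G\<^esub> v = v \<otimes>\<^bsub>G\<^esub> g" "h \<otimes>\<^bsub>G\<^esub> v = v \<otimes>\<^bsub>G\<^esub> h"
  shows "theta A \<sigma> (g \<otimes>\<^bsub>G\<^esub> h) v = theta A \<sigma> g v \<otimes>\<^bsub>A\<^esub> theta A \<sigma> h v"
proof -
  define a p b q d r s f t where def:
    "a = \<sigma> (g, h)" "p = \<sigma> (g \<otimes>\<^bsub>G\<^esub> h, v)" "b = \<sigma> (h, v)" "q = \<sigma> (g, h \<otimes>\<^bsub>G\<^esub> v)" "d = \<sigma> (v, g)"
    "r = \<sigma> (g \<otimes>\<^bsub>G\<^esub> v, h)" "s = \<sigma> (v, g \<otimes>\<^bsub>G\<^esub> h)" "f = \<sigma> (g, v)" "t = \<sigma> (v, h)"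
  have c: "a \<in> carrier A" "p \<in> carrier A" "b \<in> carrier A" "q \<in> carrier A" "d \<in> carrier A"
    "r \<in> carrier A" "s \<in> carrier A" "f \<in> carrier A" "t \<in> carrier A"
    using twococyclesD(1) [OF \<sigma>] g by (simp_all add: def)
  have 1: "a \<otimes>\<^bsub>A\<^esub> p = b \<otimes>\<^bsub>A\<^esub> q"
    using twococyclesD(4) [OF \<sigma> g] by (simp add: def)
  have 2: "d \<otimes>\<^bsub>A\<^esub> r = a \<otimes>\<^bsub>A\<^esub> s"
    using twococyclesD(4) [OF \<sigma> g(3,1,2)] comm by (simp add: def)
  have 3: "f \<otimes>\<^bsub>A\<^esub> r = t \<otimes>\<^bsub>A\<^esub> q"
    using twococyclesD(4) [OF \<sigma> g(1,3,2)] comm by (simp add: def)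
  \<comment> \<open>The product of the first two identities, rewritten by the third, is the claim up
    to the common factor made of a and r.\<close>
  have "(a \<otimes>\<^bsub>A\<^esub> r) \<otimes>\<^bsub>A\<^esub> (p \<otimes>\<^bsub>A\<^esub> (d \<otimes>\<^bsub>A\<^esub> t)) = (a \<otimes>\<^bsub>A\<^esub> p) \<otimes>\<^bsub>A\<^esub> (d \<otimes>\<^bsub>A\<^esub> r) \<otimes>\<^bsub>A\<^esub> t"
    using c by (simp add: A.m_ac)
  also have "\<dots> = b \<otimes>\<^bsub>A\<^esub> (a \<otimes>\<^bsub>A\<^esub> s) \<otimes>\<^bsub>A\<^esub> (t \<otimes>\<^bsub>A\<^esub> q)"
    unfolding 1 2 using c by (simp add: A.m_ac)
  also have "\<dots> = (a \<otimes>\<^bsub>A\<^esub> r) \<otimes>\<^bsub>A\<^esub> (f \<otimes>\<^bsub>A\<^esub> (b \<otimes>\<^bsub>A\<^esub> s))"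
    unfolding 3 [symmetric] using c by (simp add: A.m_ac)
  finally have *: "p \<otimes>\<^bsub>A\<^esub> (d \<otimes>\<^bsub>A\<^esub> t) = f \<otimes>\<^bsub>A\<^esub> (b \<otimes>\<^bsub>A\<^esub> s)"
    using c by simp
  have "p \<otimes>\<^bsub>A\<^esub> inv\<^bsub>A\<^esub> s = (p \<otimes>\<^bsub>A\<^esub> (d \<otimes>\<^bsub>A\<^esub> t)) \<otimes>\<^bsub>A\<^esub> inv\<^bsub>A\<^esub> (d \<otimes>\<^bsub>A\<^esub> t) \<otimes>\<^bsub>A\<^esub> inv\<^bsub>A\<^esub> s"
    using c by (simp add: A.m_assoc)
  also have "\<dots> = f \<otimes>\<^bsub>A\<^esub> inv\<^bsub>A\<^esub> d \<otimes>\<^bsub>A\<^esub> (b \<otimes>\<^bsub>A\<^esub> inv\<^bsub>A\<^esub> t) \<otimes>\<^bsub>A\<^esub> (s \<otimes>\<^bsub>A\<^esub> inv\<^bsub>A\<^esub> s)"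
    unfolding * by (simp only: A.inv_mult A.m_ac A.m_closed A.inv_closed c)
  finally have "p \<otimes>\<^bsub>A\<^esub> inv\<^bsub>A\<^esub> s = f \<otimes>\<^bsub>A\<^esub> inv\<^bsub>A\<^esub> d \<otimes>\<^bsub>A\<^esub> (b \<otimes>\<^bsub>A\<^esub> inv\<^bsub>A\<^esub> t)"
    using c by simp
  then show ?thesis by (simp add: theta_def def)
qed

lemma theta_mult_right:
  assumes \<sigma>: "\<sigma> \<in> twococycles G A" and g: "g \<in> carrier G" "h \<in> carrier G" "v \<in> carrier G"
    and comm: "g \<otimes>\<^bsub>G\<^esub> v = v \<otimes>\<^bsub>G\<^esub> g" "h \<otimes>\<^bsub>G\<^esub> v = v \<otimes>\<^bsub>G\<^esub> h"
  shows "theta A \<sigma> v (g \<otimes>\<^bsub>G\<^esub> h) = theta A \<sigma> v g \<otimes>\<^bsub>A\<^esub> theta A \<sigma> v h"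
  using theta_mult_left [OF assms] g
  by (simp add: theta_swap [OF \<sigma>, of _ v] theta_closed [OF \<sigma>] A.inv_mult)

end

section \<open>The twisted product\<close>

lemma parity_cong: "even (a::nat) = even (b + c) \<Longrightarrow> [int a = int b + int c] (mod 2)"
  unfolding cong_def by presburger

text \<open>A half adder with carry \<open>p * q\<close> and sum bit r. If x is a square root of
  \<epsilon>, the power of x with exponent \<open>p + q\<close> thus splits into \<epsilon> to the
  carry and x to the sum bit.\<close>

lemma bit_add:
  fixes p q r :: nat
  assumes "p \<in> {0, 1}" "q \<in> {0, 1}" "r \<in> {0, 1}" "even r = even (p + q)"
  shows "p + q = 2 * (p * q) + r"
  using assms by auto

text \<open>The carry of addition in \<open>\<int>/4\<close> splits the product of the low bits.\<close>

lemma mod_4_carry: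
  fixes a b :: int and p q :: nat
  assumes "a \<in> {0, 1, 2, 3}" "b \<in> {0, 1, 2, 3}" "even p = even a" "even q = even b"
  shows "even (nat (a div 2) + nat (b div 2)) = even (p * q + nat ((a + b) mod 4 div 2))"
  using assms by auto

text \<open>The multiplicative group of K is replaced by an abelian group in which 1 and \<epsilon>
  are the only square roots of 1, with \<epsilon> in the role of -1.\<close>

locale central_involution = trivial_module G A
  for G :: "('a, 'm) monoid_scheme" and A :: "('b, 'n) monoid_scheme" +
  fixes u :: 'a and \<epsilon> :: 'b
  assumes fin_G: "finite (carrier G)"
    and u [simp]: "u \<in> carrier G" and central: "g \<in> carrier G \<Longrightarrow> u \<otimes>\<^bsub>G\<^esub> g = g \<otimes>\<^bsub>G\<^esub> u"
    and uu: "u \<otimes>\<^bsub>G\<^esub> u = \<one>\<^bsub>G\<^esub>"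
    and \<epsilon> [simp]: "\<epsilon> \<in> carrier A" and \<epsilon>\<epsilon>: "\<epsilon> \<otimes>\<^bsub>A\<^esub> \<epsilon> = \<one>\<^bsub>A\<^esub>" and \<epsilon>_neq: "\<epsilon> \<noteq> \<one>\<^bsub>A\<^esub>"
    and roots: "\<lbrakk>a \<in> carrier A; a \<otimes>\<^bsub>A\<^esub> a = \<one>\<^bsub>A\<^esub>\<rbrakk> \<Longrightarrow> a = \<one>\<^bsub>A\<^esub> \<or> a = \<epsilon>"
begin

definition parity :: "('a \<times> 'a \<Rightarrow> 'b) \<Rightarrow> 'a \<Rightarrow> nat"
  where "parity \<sigma> g = (THE e. e \<in> {0, 1} \<and> \<epsilon> [^]\<^bsub>A\<^esub> e = theta A \<sigma> g u)"

definition sign_form :: "('a \<Rightarrow> nat) \<Rightarrow> ('a \<Rightarrow> nat) \<Rightarrow> 'a \<times> 'a \<Rightarrow> 'b"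
  where "sign_form \<chi> \<psi> = (\<lambda>(g, h)\<in>carrier G \<times> carrier G. \<epsilon> [^]\<^bsub>A\<^esub> (\<chi> g * \<psi> h))"

abbreviation parity_form :: "('a \<times> 'a \<Rightarrow> 'b) \<Rightarrow> ('a \<times> 'a \<Rightarrow> 'b) \<Rightarrow> 'a \<times> 'a \<Rightarrow> 'b"
  where "parity_form \<sigma> \<tau> \<equiv> sign_form (parity \<sigma>) (parity \<tau>)"

text \<open>The sharp product, with its sign factor split off as a cochain of its own; cosets can
  then be computed in \<open>Z2\<close>.\<close>

definition Z2_twisted :: "('a \<times> 'a \<Rightarrow> 'b) monoid"
  where "Z2_twisted = (Z2 G A)\<lparr>monoid.mult := \<lambda>\<sigma> \<tau>. \<sigma> \<otimes>\<^bsub>Z2 G A\<^esub> \<tau> \<otimes>\<^bsub>Z2 G A\<^esub> parity_form \<sigma> \<tau>\<rparr>"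

lemma sign_power: "\<epsilon> [^]\<^bsub>A\<^esub> (n::nat) = (if even n then \<one>\<^bsub>A\<^esub> else \<epsilon>)"
  by (induction n) (auto simp: \<epsilon>\<epsilon>)

lemma sign_power_eq_iff: "\<epsilon> [^]\<^bsub>A\<^esub> (m::nat) = \<epsilon> [^]\<^bsub>A\<^esub> (n::nat) \<longleftrightarrow> even m = even n"
  using \<epsilon>_neq by (auto simp: sign_power)

lemma theta_u_square:
  assumes "\<sigma> \<in> twococycles G A" "g \<in> carrier G"
  shows "theta A \<sigma> g u \<otimes>\<^bsub>A\<^esub> theta A \<sigma> g u = \<one>\<^bsub>A\<^esub>"
  using theta_mult_right [OF assms(1) u u assms(2)] central [OF assms(2)] theta_one [OF assms]
  by (simp add: uu)

text \<open>By \<open>theta_u_square\<close> theta at u is a square root of 1, hence a power of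
  \<epsilon> with a unique exponent in \<open>{0, 1}\<close>.\<close>

lemma parity_cases:
  assumes "\<sigma> \<in> twococycles G A" "g \<in> carrier G"
  shows "parity \<sigma> g \<in> {0, 1}" and "\<epsilon> [^]\<^bsub>A\<^esub> parity \<sigma> g = theta A \<sigma> g u"
proof -
  have "theta A \<sigma> g u = \<epsilon> [^]\<^bsub>A\<^esub> (0::nat) \<or> theta A \<sigma> g u = \<epsilon> [^]\<^bsub>A\<^esub> (1::nat)"
    using roots [OF theta_closed [OF assms u] theta_u_square [OF assms]] by (simp add: sign_power)
  then obtain e :: nat where e: "e \<in> {0, 1}" "\<epsilon> [^]\<^bsub>A\<^esub> e = theta A \<sigma> g u"
    by (metis insertI1 insertI2)
  then have "\<exists>!e::nat. e \<in> {0, 1} \<and> \<epsilon> [^]\<^bsub>A\<^esub> e = theta A \<sigma> g u"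
    using sign_power_eq_iff by (intro ex1I [of _ e]) (metis (no_types) insertE even_zero odd_one singletonD)+
  from theI' [OF this]
  show "parity \<sigma> g \<in> {0, 1}" and "\<epsilon> [^]\<^bsub>A\<^esub> parity \<sigma> g = theta A \<sigma> g u"
    unfolding parity_def by blast+
qed

text \<open>Since u is central, theta at u is multiplicative in g; parity is therefore a
  homomorphism to the integers modulo 2.\<close>

lemma parity_mult:
  assumes \<sigma>: "\<sigma> \<in> twococycles G A" and g: "g \<in> carrier G" "h \<in> carrier G"
  shows "even (parity \<sigma> (g \<otimes>\<^bsub>G\<^esub> h)) = even (parity \<sigma> g + parity \<sigma> h)"
proof -
  have "\<epsilon> [^]\<^bsub>A\<^esub> parity \<sigma> (g \<otimes>\<^bsub>G\<^esub> h) = \<epsilon> [^]\<^bsub>A\<^esub> (parity \<sigma> g + parity \<sigma> h)"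
    using g by (simp add: parity_cases(2) [OF \<sigma>] theta_mult_left [OF \<sigma>] central A.nat_pow_mult [symmetric])
  then show ?thesis by (simp only: sign_power_eq_iff)
qed

lemma parity_mult_cocycle:
  assumes \<sigma>: "\<sigma> \<in> twococycles G A" and \<tau>: "\<tau> \<in> twococycles G A" and g: "g \<in> carrier G"
  shows "even (parity (\<sigma> \<otimes>\<^bsub>Z2 G A\<^esub> \<tau>) g) = even (parity \<sigma> g + parity \<tau> g)"
proof -
  have "\<sigma> \<otimes>\<^bsub>Z2 G A\<^esub> \<tau> \<in> twococycles G A" using Z2.m_closed \<sigma> \<tau> by simp
  then have "\<epsilon> [^]\<^bsub>A\<^esub> parity (\<sigma> \<otimes>\<^bsub>Z2 G A\<^esub> \<tau>) g = \<epsilon> [^]\<^bsub>A\<^esub> (parity \<sigma> g + parity \<tau> g)"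
    using g \<sigma> \<tau> by (simp add: parity_cases(2) theta_mult_cocycle A.nat_pow_mult [symmetric])
  then show ?thesis by (simp only: sign_power_eq_iff)
qed

lemma parity_eq_0:
  assumes "\<sigma> \<in> twococycles G A" "g \<in> carrier G" "theta A \<sigma> g u = \<one>\<^bsub>A\<^esub>"
  shows "parity \<sigma> g = 0"
  using parity_cases [OF assms(1,2)] assms(3) \<epsilon>_neq by auto

lemma parity_one: "\<sigma> \<in> twococycles G A \<Longrightarrow> parity \<sigma> \<one>\<^bsub>G\<^esub> = 0"
  by (simp add: parity_eq_0 theta_def twococyclesD)

lemma parity_u: "\<sigma> \<in> twococycles G A \<Longrightarrow> parity \<sigma> u = 0"
  by (simp add: parity_eq_0 theta_self)

lemma parity_coboundary: "\<lbrakk>\<sigma> \<in> twocoboundaries G A; g \<in> carrier G\<rbrakk> \<Longrightarrow> parity \<sigma> g = 0"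
  by (simp add: parity_eq_0 theta_coboundary coboundary_cocycle central)

lemma sign_form_apply [simp]:
  "\<lbrakk>g \<in> carrier G; h \<in> carrier G\<rbrakk> \<Longrightarrow> sign_form \<chi> \<psi> (g, h) = \<epsilon> [^]\<^bsub>A\<^esub> (\<chi> g * \<psi> h)"
  by (simp add: sign_form_def)

lemma sign_form_extensional [simp]: "sign_form \<chi> \<psi> \<in> extensional (carrier G \<times> carrier G)"
  by (simp add: sign_form_def)

lemma mult_Z2_extensional [simp]: "\<sigma> \<otimes>\<^bsub>Z2 G A\<^esub> \<tau> \<in> extensional (carrier G \<times> carrier G)"
  by (simp add: mult_Z2)

text \<open>The product of two homomorphisms into the integers modulo 2 is a bilinear form, and
  bilinear forms are normalized cocycles.\<close>

lemma parity_form_cocycle: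
  assumes \<sigma>: "\<sigma> \<in> twococycles G A" and \<tau>: "\<tau> \<in> twococycles G A"
  shows "parity_form \<sigma> \<tau> \<in> twococycles G A"
  unfolding sign_form_def
proof (rule twococyclesI, unfold prod.case)
  fix g h l assume g: "g \<in> carrier G" "h \<in> carrier G" "l \<in> carrier G"
  have "\<epsilon> [^]\<^bsub>A\<^esub> (parity \<sigma> g * parity \<tau> h + parity \<sigma> (g \<otimes>\<^bsub>G\<^esub> h) * parity \<tau> l)
      = \<epsilon> [^]\<^bsub>A\<^esub> (parity \<sigma> h * parity \<tau> l + parity \<sigma> g * parity \<tau> (h \<otimes>\<^bsub>G\<^esub> l))"
    unfolding sign_power_eq_iff using g by (auto simp: parity_mult \<sigma> \<tau>)
  then show "\<epsilon> [^]\<^bsub>A\<^esub> (parity \<sigma> g * parity \<tau> h) \<otimes>\<^bsub>A\<^esub> \<epsilon> [^]\<^bsub>A\<^esub> (parity \<sigma> (g \<otimes>\<^bsub>G\<^esub> h) * parity \<tau> l)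
      = \<epsilon> [^]\<^bsub>A\<^esub> (parity \<sigma> h * parity \<tau> l) \<otimes>\<^bsub>A\<^esub> \<epsilon> [^]\<^bsub>A\<^esub> (parity \<sigma> g * parity \<tau> (h \<otimes>\<^bsub>G\<^esub> l))"
    by (simp add: A.nat_pow_mult)
qed (simp_all add: parity_one \<sigma> \<tau>)

text \<open>At \<open>(g, u)\<close> and \<open>(u, g)\<close> the exponent contains the parity of
  u, which is 0 because theta is trivial at \<open>(u, u)\<close>. Hence the pairing takes its
  values in its own radical.\<close>

lemma parity_parity_form:
  assumes \<sigma>: "\<sigma> \<in> twococycles G A" and \<tau>: "\<tau> \<in> twococycles G A" and g: "g \<in> carrier G"
  shows "parity (parity_form \<sigma> \<tau>) g = 0"
  by (rule parity_eq_0 [OF parity_form_cocycle [OF \<sigma> \<tau>] g])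
    (use g in \<open>simp add: theta_def parity_u \<sigma> \<tau>\<close>)

lemma sign_form_cong:
  assumes "\<And>g. g \<in> carrier G \<Longrightarrow> even (\<chi> g) = even (\<chi>' g)"
    and "\<And>g. g \<in> carrier G \<Longrightarrow> even (\<psi> g) = even (\<psi>' g)"
  shows "sign_form \<chi> \<psi> = sign_form \<chi>' \<psi>'"
  by (rule twococycle_eqI) (simp_all add: sign_power_eq_iff assms)

lemma parity_form_mult_left:
  assumes "\<sigma> \<in> twococycles G A" "\<tau> \<in> twococycles G A" "\<omega> \<in> twococycles G A"
  shows "parity_form (\<sigma> \<otimes>\<^bsub>Z2 G A\<^esub> \<tau>) \<omega> = parity_form \<sigma> \<omega> \<otimes>\<^bsub>Z2 G A\<^esub> parity_form \<tau> \<omega>"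
  by (rule twococycle_eqI)
    (simp_all add: A.nat_pow_mult sign_power_eq_iff parity_mult_cocycle assms, blast)

lemma parity_form_mult_right:
  assumes "\<sigma> \<in> twococycles G A" "\<tau> \<in> twococycles G A" "\<omega> \<in> twococycles G A"
  shows "parity_form \<omega> (\<sigma> \<otimes>\<^bsub>Z2 G A\<^esub> \<tau>) = parity_form \<omega> \<sigma> \<otimes>\<^bsub>Z2 G A\<^esub> parity_form \<omega> \<tau>"
  by (rule twococycle_eqI)
    (simp_all add: A.nat_pow_mult sign_power_eq_iff parity_mult_cocycle assms, blast)

lemma parity_form_square:
  "parity_form \<sigma> \<tau> \<otimes>\<^bsub>Z2 G A\<^esub> parity_form \<sigma> \<tau> = \<one>\<^bsub>Z2 G A\<^esub>"
  by (rule twococycle_eqI) (simp_all add: A.nat_pow_mult sign_power \<epsilon>\<epsilon>)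

text \<open>Coboundaries have parity 0, so cohomologous cocycles give equal forms and not merely
  cohomologous ones. Hence the form descends to classes.\<close>

lemma parity_form_coboundary:
  assumes "\<beta> \<in> twocoboundaries G A" "\<beta>' \<in> twocoboundaries G A" "\<sigma> \<in> twococycles G A" "\<tau> \<in> twococycles G A"
  shows "parity_form (\<beta> \<otimes>\<^bsub>Z2 G A\<^esub> \<sigma>) (\<beta>' \<otimes>\<^bsub>Z2 G A\<^esub> \<tau>) = parity_form \<sigma> \<tau>"
  by (rule sign_form_cong) (simp_all add: parity_mult_cocycle parity_coboundary coboundary_cocycle assms)

lemma parity_form_parity_form:
  assumes "\<sigma> \<in> twococycles G A" "\<tau> \<in> twococycles G A"
  shows "parity_form (parity_form \<sigma> \<tau>) \<omega> = \<one>\<^bsub>Z2 G A\<^esub>"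
  by (rule twococycle_eqI) (simp_all add: parity_parity_form assms)

section \<open>Cohomology classes under the ordinary and the twisted product\<close>

abbreviation cohomology_class :: "('a \<times> 'a \<Rightarrow> 'b) \<Rightarrow> ('a \<times> 'a \<Rightarrow> 'b) set"
  where "cohomology_class \<sigma> \<equiv> twocoboundaries G A #>\<^bsub>Z2 G A\<^esub> \<sigma>"

lemma carrier_H2: "carrier (H2 G A) = cohomology_class ` twococycles G A"
  by (simp add: H2_def carrier_FactGroup)

lemma mult_H2:
  "\<lbrakk>\<sigma> \<in> twococycles G A; \<tau> \<in> twococycles G A\<rbrakk> \<Longrightarrow>
    cohomology_class \<sigma> \<otimes>\<^bsub>H2 G A\<^esub> cohomology_class \<tau> = cohomology_class (\<sigma> \<otimes>\<^bsub>Z2 G A\<^esub> \<tau>)"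
  by (simp add: H2_def B2.rcos_sum)

lemma cohomology_classD:
  "\<tau> \<in> cohomology_class \<sigma> \<Longrightarrow> \<exists>\<beta>\<in>twocoboundaries G A. \<tau> = \<beta> \<otimes>\<^bsub>Z2 G A\<^esub> \<sigma>"
  by (auto simp: r_coset_def)

text \<open>The sign form is the same cochain for all representatives, so the twisted product of two
  cosets is their ordinary product translated by it.\<close>

lemma class_mult_twisted:
  assumes \<sigma>: "\<sigma> \<in> twococycles G A" and \<tau>: "\<tau> \<in> twococycles G A"
  shows "cohomology_class \<sigma> <#>\<^bsub>Z2_twisted\<^esub> cohomology_class \<tau> =
    cohomology_class (\<sigma> \<otimes>\<^bsub>Z2 G A\<^esub> \<tau> \<otimes>\<^bsub>Z2 G A\<^esub> parity_form \<sigma> \<tau>)"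
proof -
  have *: "parity_form h k = parity_form \<sigma> \<tau>" if "h \<in> cohomology_class \<sigma>" "k \<in> cohomology_class \<tau>" for h k
    using cohomology_classD [OF that(1)] cohomology_classD [OF that(2)] parity_form_coboundary \<sigma> \<tau> by blast
  have "cohomology_class \<sigma> <#>\<^bsub>Z2_twisted\<^esub> cohomology_class \<tau> =
      (\<Union>h\<in>cohomology_class \<sigma>. \<Union>k\<in>cohomology_class \<tau>. {h \<otimes>\<^bsub>Z2 G A\<^esub> k \<otimes>\<^bsub>Z2 G A\<^esub> parity_form \<sigma> \<tau>})"
    unfolding set_mult_def by (intro SUP_cong refl) (simp add: Z2_twisted_def *)
  also have "\<dots> = (cohomology_class \<sigma> <#>\<^bsub>Z2 G A\<^esub> cohomology_class \<tau>) #>\<^bsub>Z2 G A\<^esub> parity_form \<sigma> \<tau>"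
    unfolding set_mult_def r_coset_def by blast
  also have "\<dots> = cohomology_class (\<sigma> \<otimes>\<^bsub>Z2 G A\<^esub> \<tau> \<otimes>\<^bsub>Z2 G A\<^esub> parity_form \<sigma> \<tau>)"
    using \<sigma> \<tau> parity_form_cocycle [OF \<sigma> \<tau>] Z2.m_closed [of \<sigma> \<tau>]
    by (simp add: B2.rcos_sum Z2.coset_mult_assoc [OF B2.subset])
  finally show ?thesis .
qed

text \<open>A left factor of parity 0 makes the sign trivial.\<close>

lemma class_twisted:
  assumes \<sigma>: "\<sigma> \<in> twococycles G A"
  shows "twocoboundaries G A #>\<^bsub>Z2_twisted\<^esub> \<sigma> = cohomology_class \<sigma>"
proof -
  have "\<beta> \<otimes>\<^bsub>Z2_twisted\<^esub> \<sigma> = \<beta> \<otimes>\<^bsub>Z2 G A\<^esub> \<sigma>" if \<beta>: "\<beta> \<in> twocoboundaries G A" for \<beta>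
    by (rule twococycle_eqI)
      (simp_all add: Z2_twisted_def parity_coboundary \<beta> twococyclesD [OF \<sigma>]
        twococyclesD [OF coboundary_cocycle [OF \<beta>]])
  then show ?thesis by (simp add: r_coset_def)
qed

definition class_pairing :: "('a \<times> 'a \<Rightarrow> 'b) set \<Rightarrow> ('a \<times> 'a \<Rightarrow> 'b) set \<Rightarrow> ('a \<times> 'a \<Rightarrow> 'b) set"
  where "class_pairing c d = cohomology_class (parity_form (SOME \<sigma>. \<sigma> \<in> c) (SOME \<tau>. \<tau> \<in> d))"

lemma class_pairing_class:
  assumes \<sigma>: "\<sigma> \<in> twococycles G A" and \<tau>: "\<tau> \<in> twococycles G A"
  shows "class_pairing (cohomology_class \<sigma>) (cohomology_class \<tau>) = cohomology_class (parity_form \<sigma> \<tau>)"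
proof -
  have "(SOME x. x \<in> cohomology_class \<rho>) \<in> cohomology_class \<rho>" if "\<rho> \<in> twococycles G A" for \<rho>
    using Z2.rcos_self [OF _ subgroup_twocoboundaries, of \<rho>] that unfolding some_in_eq by auto
  note some = this
  obtain \<beta> where \<beta>: "\<beta> \<in> twocoboundaries G A" "(SOME x. x \<in> cohomology_class \<sigma>) = \<beta> \<otimes>\<^bsub>Z2 G A\<^esub> \<sigma>"
    using cohomology_classD [OF some [OF \<sigma>]] by blast
  obtain \<beta>' where \<beta>': "\<beta>' \<in> twocoboundaries G A" "(SOME x. x \<in> cohomology_class \<tau>) = \<beta>' \<otimes>\<^bsub>Z2 G A\<^esub> \<tau>"
    using cohomology_classD [OF some [OF \<tau>]] by blast
  show ?thesis
    unfolding class_pairing_def \<beta>(2) \<beta>'(2) parity_form_coboundary [OF \<beta>(1) \<beta>'(1) \<sigma> \<tau>] ..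
qed

text \<open>The function \<open>class_pairing c\<close> is determined by the parity of one
  representative of c, and there are only finitely many maps from G to \<open>{0, 1}\<close>. This
  holds even where \<open>H2\<close> is infinite.\<close>

lemma finite_class_pairing: "finite (class_pairing ` carrier (H2 G A))"
proof -
  \<comment> \<open>The choice of a representative of d stays inside F, so that the functions agree
    at every set d and not only at classes.\<close>
  define F where "F \<chi> d = cohomology_class (sign_form \<chi> (parity (SOME \<tau>. \<tau> \<in> d)))" for \<chi> d
  have "class_pairing c \<in> F ` (carrier G \<rightarrow>\<^sub>E {0, 1})" if c: "c \<in> carrier (H2 G A)" for c
  proof
    define \<rho> where "\<rho> = (SOME \<sigma>. \<sigma> \<in> c)"
    obtain \<sigma> where \<sigma>: "\<sigma> \<in> twococycles G A" "c = cohomology_class \<sigma>"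
      using c by (auto simp: carrier_H2)
    then have "\<sigma> \<in> c"
      using Z2.rcos_self [OF _ subgroup_twocoboundaries] by simp
    then have "\<rho> \<in> c" unfolding \<rho>_def some_in_eq by blast
    then obtain \<beta> where "\<beta> \<in> twocoboundaries G A" "\<rho> = \<beta> \<otimes>\<^bsub>Z2 G A\<^esub> \<sigma>"
      using \<sigma>(2) cohomology_classD by blast
    then have "\<rho> \<in> twococycles G A"
      using \<sigma>(1) coboundary_cocycle Z2.m_closed [of \<beta> \<sigma>] by simp
    then show "restrict (parity \<rho>) (carrier G) \<in> carrier G \<rightarrow>\<^sub>E {0, 1}"
      using parity_cases(1) by auto
    have restrict: "sign_form (restrict (parity \<rho>) (carrier G)) \<psi> = sign_form (parity \<rho>) \<psi>" for \<psi>
      by (rule sign_form_cong) auto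
    show "class_pairing c = F (restrict (parity \<rho>) (carrier G))"
      by (rule ext) (simp only: F_def restrict class_pairing_def \<rho>_def [symmetric])
  qed
  moreover have "finite (F ` (carrier G \<rightarrow>\<^sub>E {0, 1}))"
    by (intro finite_imageI finite_PiE fin_G) simp
  ultimately show ?thesis by (meson finite_subset image_subsetI)
qed

text \<open>Bilinearity, triviality of squares and values in the radical hold already for cocycles;
  the hypothesis supplies the alternating property. On classes the twisted product is the ordinary
  one times the pairing, as \<open>iso_twisted\<close> requires.\<close>

theorem H2_iso_twisted:
  assumes self: "\<And>\<sigma>. \<sigma> \<in> twococycles G A \<Longrightarrow> parity_form \<sigma> \<sigma> \<in> twocoboundaries G A"
  shows "H2 G A \<cong> Z2_twisted Mod twocoboundaries G A"
proof -
  have m: "\<sigma> \<otimes>\<^bsub>Z2 G A\<^esub> \<tau> \<in> twococycles G A" if "\<sigma> \<in> twococycles G A" "\<tau> \<in> twococycles G A" for \<sigma> \<tau>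
    using that Z2.m_closed by simp
  have trivial: "cohomology_class \<beta> = \<one>\<^bsub>H2 G A\<^esub>" if "\<beta> \<in> twocoboundaries G A" for \<beta>
    using B2.rcos_const [OF Z2.is_group that] by (simp add: H2_def)
  have one: "\<one>\<^bsub>Z2 G A\<^esub> \<in> twocoboundaries G A" by (rule B2.one_closed)
  interpret alternating_pairing "H2 G A" class_pairing
  proof unfold_locales
    fix x y assume x: "x \<in> carrier (H2 G A)" and y: "y \<in> carrier (H2 G A)"
    obtain \<sigma> where \<sigma>: "\<sigma> \<in> twococycles G A" "x = cohomology_class \<sigma>"
      using x by (auto simp: carrier_H2)
    obtain \<tau> where \<tau>: "\<tau> \<in> twococycles G A" "y = cohomology_class \<tau>"
      using y by (auto simp: carrier_H2)
    note s = \<sigma> \<tau> class_pairing_class parity_form_cocycle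
    show "class_pairing x y \<in> carrier (H2 G A)"
      by (simp add: s carrier_H2)
    show "class_pairing x y \<otimes>\<^bsub>H2 G A\<^esub> class_pairing x y = \<one>\<^bsub>H2 G A\<^esub>"
      by (simp only: s mult_H2 parity_form_square trivial one)
    fix z assume z: "z \<in> carrier (H2 G A)"
    then obtain \<omega> where \<omega>: "\<omega> \<in> twococycles G A" "z = cohomology_class \<omega>"
      by (auto simp: carrier_H2)
    show "class_pairing (x \<otimes>\<^bsub>H2 G A\<^esub> y) z = class_pairing x z \<otimes>\<^bsub>H2 G A\<^esub> class_pairing y z"
      by (simp only: s \<omega> m mult_H2 parity_form_mult_left)
    show "class_pairing z (x \<otimes>\<^bsub>H2 G A\<^esub> y) = class_pairing z x \<otimes>\<^bsub>H2 G A\<^esub> class_pairing z y"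
      by (simp only: s \<omega> m mult_H2 parity_form_mult_right)
    show "class_pairing (class_pairing x y) z = \<one>\<^bsub>H2 G A\<^esub>"
      by (simp only: s \<omega> parity_form_parity_form trivial one)
  next
    fix x assume "x \<in> carrier (H2 G A)"
    then show "class_pairing x x = \<one>\<^bsub>H2 G A\<^esub>"
      by (auto simp: carrier_H2 class_pairing_class self trivial)
  qed (rule finite_class_pairing)
  show ?thesis
  proof (rule iso_twisted)
    have "carrier Z2_twisted = twococycles G A" by (simp add: Z2_twisted_def)
    then show "carrier (Z2_twisted Mod twocoboundaries G A) = carrier (H2 G A)"
      unfolding carrier_FactGroup carrier_H2 by (intro image_cong) (simp_all add: class_twisted)
  next
    fix x y assume "x \<in> carrier (H2 G A)" "y \<in> carrier (H2 G A)"
    then show "x \<otimes>\<^bsub>Z2_twisted Mod twocoboundaries G A\<^esub> y = x \<otimes>\<^bsub>H2 G A\<^esub> y \<otimes>\<^bsub>H2 G A\<^esub> class_pairing x y"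
      by (auto simp: carrier_H2 class_pairing_class class_mult_twisted mult_H2 m parity_form_cocycle)
  qed
qed

section \<open>Criteria for a diagonal form to be a coboundary\<close>

text \<open>The cochain is x to the power of the parity. By \<open>bit_add\<close> its failure to be
  multiplicative is the square of x raised to the product of the parities.\<close>

lemma parity_form_self_coboundary_sqrt:
  assumes \<sigma>: "\<sigma> \<in> twococycles G A" and x: "x \<in> carrier A" "x \<otimes>\<^bsub>A\<^esub> x = \<epsilon>"
  shows "parity_form \<sigma> \<sigma> \<in> twocoboundaries G A"
  unfolding twocoboundaries_iff
proof (intro conjI bexI [of _ "\<lambda>g. x [^]\<^bsub>A\<^esub> parity \<sigma> g"] ballI)
  fix g h assume g: "g \<in> carrier G" "h \<in> carrier G"
  have "parity \<sigma> g + parity \<sigma> h = 2 * (parity \<sigma> g * parity \<sigma> h) + parity \<sigma> (g \<otimes>\<^bsub>G\<^esub> h)"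
    using parity_cases(1) [OF \<sigma>] parity_mult [OF \<sigma> g] g by (intro bit_add) simp_all
  then have "x [^]\<^bsub>A\<^esub> parity \<sigma> g \<otimes>\<^bsub>A\<^esub> x [^]\<^bsub>A\<^esub> parity \<sigma> h =
      x [^]\<^bsub>A\<^esub> (2 * (parity \<sigma> g * parity \<sigma> h)) \<otimes>\<^bsub>A\<^esub> x [^]\<^bsub>A\<^esub> parity \<sigma> (g \<otimes>\<^bsub>G\<^esub> h)"
    using x by (simp add: A.nat_pow_mult)
  also have "x [^]\<^bsub>A\<^esub> (2 * (parity \<sigma> g * parity \<sigma> h)) = (x [^]\<^bsub>A\<^esub> (2::nat)) [^]\<^bsub>A\<^esub> (parity \<sigma> g * parity \<sigma> h)"
    using x by (simp add: A.nat_pow_pow)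
  also have "x [^]\<^bsub>A\<^esub> (2::nat) = \<epsilon>"
    using x by (simp add: numeral_2_eq_2)
  finally show "x [^]\<^bsub>A\<^esub> parity \<sigma> g \<otimes>\<^bsub>A\<^esub> x [^]\<^bsub>A\<^esub> parity \<sigma> h =
      parity_form \<sigma> \<sigma> (g, h) \<otimes>\<^bsub>A\<^esub> x [^]\<^bsub>A\<^esub> parity \<sigma> (g \<otimes>\<^bsub>G\<^esub> h)"
    using g by simp
qed (simp_all add: x parity_one \<sigma>)

text \<open>The cochain is \<epsilon> to the high bit of \<open>L g mod 4\<close>. High bits add up
  except for the carry, which is the product of the low bits, and the low bits are the
  parities.\<close>

lemma parity_form_self_coboundary_lift:
  fixes L :: "'a \<Rightarrow> int"
  assumes \<sigma>: "\<sigma> \<in> twococycles G A"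
    and L: "\<And>g h. \<lbrakk>g \<in> carrier G; h \<in> carrier G\<rbrakk> \<Longrightarrow> [L (g \<otimes>\<^bsub>G\<^esub> h) = L g + L h] (mod 4)"
    and lift: "\<And>g. g \<in> carrier G \<Longrightarrow> [L g = int (parity \<sigma> g)] (mod 2)"
  shows "parity_form \<sigma> \<sigma> \<in> twocoboundaries G A"
  unfolding twocoboundaries_iff
proof (intro conjI bexI [of _ "\<lambda>g. \<epsilon> [^]\<^bsub>A\<^esub> (nat (L g mod 4 div 2))"] ballI)
  \<comment> \<open>Additivity modulo 4 makes the value of L at the identity divisible by 4, so the
    cochain is normalized.\<close>
  have "[L \<one>\<^bsub>G\<^esub> + 0 = L \<one>\<^bsub>G\<^esub> + L \<one>\<^bsub>G\<^esub>] (mod 4)"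
    using L [of "\<one>\<^bsub>G\<^esub>" "\<one>\<^bsub>G\<^esub>"] by simp
  then have "L \<one>\<^bsub>G\<^esub> mod 4 = 0"
    unfolding cong_add_lcancel by (simp add: cong_def)
  then show "\<epsilon> [^]\<^bsub>A\<^esub> (nat (L \<one>\<^bsub>G\<^esub> mod 4 div 2)) = \<one>\<^bsub>A\<^esub>" by simp
next
  fix g h assume g: "g \<in> carrier G" "h \<in> carrier G"
  have range: "L x mod 4 \<in> {0, 1, 2, 3}" for x
    using pos_mod_bound [of 4 "L x"] pos_mod_sign [of 4 "L x"] by auto
  have odd: "even (parity \<sigma> x) = even (L x mod 4)" if "x \<in> carrier G" for x
    using lift [OF that] by (metis cong_dvd_iff dvd_mod_iff even_numeral even_of_nat)
  have "L (g \<otimes>\<^bsub>G\<^esub> h) mod 4 = (L g mod 4 + L h mod 4) mod 4"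
    using L [OF g] by (simp add: cong_def mod_add_eq)
  then have "even (nat (L g mod 4 div 2) + nat (L h mod 4 div 2)) =
      even (parity \<sigma> g * parity \<sigma> h + nat (L (g \<otimes>\<^bsub>G\<^esub> h) mod 4 div 2))"
    using range odd g by (simp only: mod_4_carry)
  then show "\<epsilon> [^]\<^bsub>A\<^esub> nat (L g mod 4 div 2) \<otimes>\<^bsub>A\<^esub> \<epsilon> [^]\<^bsub>A\<^esub> nat (L h mod 4 div 2) =
      parity_form \<sigma> \<sigma> (g, h) \<otimes>\<^bsub>A\<^esub> \<epsilon> [^]\<^bsub>A\<^esub> nat (L (g \<otimes>\<^bsub>G\<^esub> h) mod 4 div 2)"
    unfolding sign_form_apply [OF g] A.nat_pow_mult [OF \<epsilon>] sign_power_eq_iff .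
qed simp_all

text \<open>An odd index is 1 modulo 2, so the transfer turns a lift modulo 4 of the parity on S
  into a lift on G.\<close>

lemma parity_form_self_coboundary_odd_index:
  assumes \<sigma>: "\<sigma> \<in> twococycles G A" and S: "subgroup S G" and "odd (card (rcosets\<^bsub>G\<^esub> S))"
    and \<psi>: "\<And>s t. \<lbrakk>s \<in> S; t \<in> S\<rbrakk> \<Longrightarrow> [\<psi> (s \<otimes>\<^bsub>G\<^esub> t) = \<psi> s + \<psi> t] (mod 4)"
    and lift: "\<And>s. s \<in> S \<Longrightarrow> [\<psi> s = int (parity \<sigma> s)] (mod 2)"
  shows "parity_form \<sigma> \<sigma> \<in> twocoboundaries G A"
proof -
  have hom: "[int (parity \<sigma> (g \<otimes>\<^bsub>G\<^esub> h)) = int (parity \<sigma> g) + int (parity \<sigma> h)] (mod 2)"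
    if "g \<in> carrier G" "h \<in> carrier G" for g h
    using parity_mult [OF \<sigma> that] by (rule parity_cong)
  have "[int (card (rcosets\<^bsub>G\<^esub> S)) = 1] (mod 2)"
    using assms(3) unfolding cong_def by presburger
  from G.transfer_extension [where \<chi> = "\<lambda>g. int (parity \<sigma> g)", OF S fin_G \<psi> hom lift this]
  show ?thesis
    using parity_form_self_coboundary_lift [OF \<sigma>] by blast
qed

text \<open>Theta at \<open>(g, u)\<close> is the square of theta at \<open>(g, v)\<close>. It is 1
  or \<epsilon>, and \<epsilon> is not a square.\<close>

lemma parity_of_square:
  assumes \<sigma>: "\<sigma> \<in> twococycles G A" and g: "g \<in> carrier G" "v \<in> carrier G"
    and comm: "v \<otimes>\<^bsub>G\<^esub> g = g \<otimes>\<^bsub>G\<^esub> v" and v: "v \<otimes>\<^bsub>G\<^esub> v = u"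
    and no_root: "\<And>x. x \<in> carrier A \<Longrightarrow> x \<otimes>\<^bsub>A\<^esub> x \<noteq> \<epsilon>"
  shows "parity \<sigma> g = 0"
proof (rule parity_eq_0 [OF \<sigma> g(1)])
  have "theta A \<sigma> g u = theta A \<sigma> g v \<otimes>\<^bsub>A\<^esub> theta A \<sigma> g v"
    using theta_mult_right [OF \<sigma> g(2,2,1) comm comm] v by simp
  then have "theta A \<sigma> g u \<noteq> \<epsilon>"
    using no_root theta_closed [OF \<sigma> g] by simp
  then show "theta A \<sigma> g u = \<one>\<^bsub>A\<^esub>"
    using roots [OF theta_closed [OF \<sigma> g(1) u] theta_u_square [OF \<sigma> g(1)]] by blast
qed

text \<open>Theta is trivial at \<open>(a, w)\<close>, so its value at \<open>(a, u)\<close> is the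
  square of its value at \<open>(a, v)\<close>. Moving the square to the first argument gives theta
  at \<open>(a \<otimes> a, v)\<close>, which is 1.\<close>

lemma parity_of_involution:
  assumes \<sigma>: "\<sigma> \<in> twococycles G A" and a: "a \<in> carrier G" "v \<in> carrier G" "w \<in> {\<one>\<^bsub>G\<^esub>, a}"
    and comm: "a \<otimes>\<^bsub>G\<^esub> v = v \<otimes>\<^bsub>G\<^esub> a" and aa: "a \<otimes>\<^bsub>G\<^esub> a = \<one>\<^bsub>G\<^esub>" and u: "u = w \<otimes>\<^bsub>G\<^esub> (v \<otimes>\<^bsub>G\<^esub> v)"
  shows "parity \<sigma> a = 0"
proof (rule parity_eq_0 [OF \<sigma> a(1)])
  have w: "w \<in> carrier G" "w \<otimes>\<^bsub>G\<^esub> a = a \<otimes>\<^bsub>G\<^esub> w" "theta A \<sigma> a w = \<one>\<^bsub>A\<^esub>"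
    using a theta_one [OF \<sigma>] theta_self [OF \<sigma>] by auto
  have vv: "(v \<otimes>\<^bsub>G\<^esub> v) \<otimes>\<^bsub>G\<^esub> a = a \<otimes>\<^bsub>G\<^esub> (v \<otimes>\<^bsub>G\<^esub> v)"
    using a comm by (metis G.m_assoc)
  have "theta A \<sigma> a u = theta A \<sigma> a w \<otimes>\<^bsub>A\<^esub> theta A \<sigma> a (v \<otimes>\<^bsub>G\<^esub> v)"
    unfolding u using theta_mult_right [OF \<sigma> w(1) _ a(1) w(2) vv] a by simp
  also have "\<dots> = theta A \<sigma> a v \<otimes>\<^bsub>A\<^esub> theta A \<sigma> a v"
    using theta_mult_right [OF \<sigma> a(2,2,1) comm [symmetric] comm [symmetric]] w(3)
      theta_closed [OF \<sigma> a(1,2)] by simp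
  also have "\<dots> = theta A \<sigma> (a \<otimes>\<^bsub>G\<^esub> a) v"
    using theta_mult_left [OF \<sigma> a(1,1,2) comm comm] by simp
  also have "\<dots> = \<one>\<^bsub>A\<^esub>"
    using aa a twococyclesD [OF \<sigma>] by (simp add: theta_def)
  finally show "theta A \<sigma> a u = \<one>\<^bsub>A\<^esub>" .
qed

end

section \<open>Sylow subgroups and the three cases\<close>

text \<open>With an even index, Lagrange would give the order of G one more factor 2 than its
  multiplicity allows.\<close>

lemma (in group) sylow_subgroup_odd_index:
  assumes fin: "finite (carrier G)" and S: "sylow_subgroup 2 S G"
  shows "odd (card (rcosets S))"
proof
  assume "even (card (rcosets S))"
  then obtain k where k: "card (rcosets S) = 2 * k" by blast
  have sub: "subgroup S G" and card: "card S = 2 ^ multiplicity 2 (order G)"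
    using S by (auto simp: sylow_subgroup_def)
  have "2 ^ Suc (multiplicity 2 (order G)) * k = order G"
    using lagrange [OF sub] unfolding k card by (simp only: power_Suc mult_ac)
  then have "2 ^ Suc (multiplicity 2 (order G)) dvd order G" by (rule dvdI [OF sym])
  moreover have "order G \<noteq> 0" using fin order_gt_0_iff_finite by simp
  ultimately have "Suc (multiplicity 2 (order G)) \<le> multiplicity 2 (order G)"
    by (intro multiplicity_geI) auto
  then show False by simp
qed

text \<open>Otherwise S and its translate by u form a subgroup of twice the order of S. That order
  divides the order of G, which forces the index of S to be even.\<close>

lemma (in group) central_involution_in_odd_index:
  assumes fin: "finite (carrier G)" and S: "subgroup S G" and odd: "odd (card (rcosets S))"
    and u: "u \<in> carrier G" and central: "\<And>g. g \<in> carrier G \<Longrightarrow> u \<otimes> g = g \<otimes> u" and uu: "u \<otimes> u = \<one>"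
  shows "u \<in> S"
proof (rule ccontr)
  assume nu: "u \<notin> S"
  interpret S: subgroup S G by (fact S)
  have Sc: "\<And>s. s \<in> S \<Longrightarrow> s \<in> carrier G" by simp
  define H where "H = S \<union> (S #> u)"
  have swap: "s \<otimes> u \<otimes> (t \<otimes> u) = s \<otimes> t" "s \<otimes> u \<otimes> t = s \<otimes> t \<otimes> u"
    "s \<otimes> (t \<otimes> u) = s \<otimes> t \<otimes> u" if "s \<in> S" "t \<in> S" for s t
  proof -
    have "s \<otimes> u \<otimes> (t \<otimes> u) = s \<otimes> (u \<otimes> t) \<otimes> u" using that u Sc by (simp add: m_assoc)
    also have "\<dots> = s \<otimes> t \<otimes> (u \<otimes> u)" using that u Sc by (simp add: m_assoc central [of t])
    finally show "s \<otimes> u \<otimes> (t \<otimes> u) = s \<otimes> t" using that uu by simp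
    show "s \<otimes> u \<otimes> t = s \<otimes> t \<otimes> u" using that u Sc by (simp add: m_assoc central [of t])
    show "s \<otimes> (t \<otimes> u) = s \<otimes> t \<otimes> u" using that u Sc by (simp add: m_assoc)
  qed
  have memH: "x \<in> H \<longleftrightarrow> x \<in> S \<or> (\<exists>s\<in>S. x = s \<otimes> u)" for x
    by (auto simp: H_def r_coset_def)
  have "subgroup H G"
  proof
    show "H \<subseteq> carrier G" using u by (auto simp: memH)
    show "\<one> \<in> H" by (simp add: memH)
    show "x \<otimes> y \<in> H" if "x \<in> H" "y \<in> H" for x y
    proof -
      from that(1) have x: "x \<in> S \<or> (\<exists>s\<in>S. x = s \<otimes> u)" by (simp only: memH)
      from that(2) have y: "y \<in> S \<or> (\<exists>s\<in>S. y = s \<otimes> u)" by (simp only: memH)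
      from x y have "\<exists>s\<in>S. x \<otimes> y = s \<or> x \<otimes> y = s \<otimes> u"
      proof (elim disjE bexE)
        fix s t assume "s \<in> S" "t \<in> S" "x = s \<otimes> u" "y = t \<otimes> u"
        then show ?thesis using swap(1) [of s t] by (intro bexI [of _ "s \<otimes> t"]) simp_all
      next
        fix s assume "s \<in> S" "x = s \<otimes> u" "y \<in> S"
        then show ?thesis using swap(2) [of s y] by (intro bexI [of _ "s \<otimes> y"]) simp_all
      next
        fix t assume "x \<in> S" "t \<in> S" "y = t \<otimes> u"
        then show ?thesis using swap(3) [of x t] by (intro bexI [of _ "x \<otimes> t"]) simp_all
      next
        assume "x \<in> S" "y \<in> S"
        then show ?thesis by (intro bexI [of _ "x \<otimes> y"]) simp_all
      qed
      then show ?thesis by (auto simp only: memH)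
    qed
    show "inv x \<in> H" if "x \<in> H" for x
    proof -
      have "inv (s \<otimes> u) = inv s \<otimes> u" if "s \<in> S" for s
        using that u swap(1) [of "inv s" s] by (intro inv_equality) simp_all
      then show ?thesis using that S.m_inv_closed unfolding memH by blast
    qed
  qed
  then have "card H dvd order G" by (metis dvd_triv_right lagrange)
  moreover have "card H = 2 * card S"
  proof -
    have "S \<inter> (S #> u) = {}"
    proof (rule ccontr)
      assume "S \<inter> (S #> u) \<noteq> {}"
      then obtain s where s: "s \<in> S" "s \<otimes> u \<in> S" by (auto simp: r_coset_def)
      then have "inv s \<otimes> (s \<otimes> u) \<in> S" by simp
      then show False using nu s u by (simp add: m_assoc [symmetric])
    qed
    moreover have "card (S #> u) = card S"
      using card_rcosets_equal [OF _ S.subset, of "S #> u"] rcosetsI [OF S.subset u] by simp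
    moreover have "finite S" "finite (S #> u)"
      using fin S.subset r_coset_subset_G [OF S.subset u] finite_subset by auto
    ultimately show ?thesis unfolding H_def by (simp add: card_Un_disjoint)
  qed
  ultimately have "2 * card S dvd card (rcosets S) * card S" using lagrange [OF S] by simp
  moreover have "card S > 0" using fin S.finite_imp_card_positive by simp
  ultimately show False using odd by simp
qed

text \<open>The residues are halved as integers; adding the halves gives back a number below the
  modulus, so no reduction takes place.\<close>

lemma product_cyclic_half:
  assumes P: "P = product_group I (\<lambda>i. integer_mod_group (2 ^ e i))"
    and x: "x \<in> carrier P" and even: "\<And>i. i \<in> I \<Longrightarrow> even (x i)"
  obtains y where "y \<in> carrier P" "y \<otimes>\<^bsub>P\<^esub> y = x"
proof
  have range: "0 \<le> x i" "x i < 2 ^ e i" if "i \<in> I" for i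
    using x that by (auto simp: P carrier_integer_mod_group PiE_iff)
  define y where "y = (\<lambda>i\<in>I. x i div 2)"
  show "y \<in> carrier P"
    using range by (fastforce simp: y_def P carrier_integer_mod_group)
  show "y \<otimes>\<^bsub>P\<^esub> y = x"
  proof
    show "(y \<otimes>\<^bsub>P\<^esub> y) i = x i" for i
    proof (cases "i \<in> I")
      case True
      then have "2 * (x i div 2) = x i"
        by (intro even_two_times_div_two even)
      then have "x i div 2 + x i div 2 = x i" by linarith
      then show ?thesis using True range by (simp add: y_def P)
    next
      case False
      then show ?thesis using x by (auto simp: P PiE_iff extensional_def)
    qed
  qed
qed

text \<open>Modulo \<open>2 ^ e i\<close> with exponent at least 2, a residue whose double vanishes
  is a multiple of half the modulus, which is still even. For exponent 0 the only residue is
  0.\<close>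

lemma product_cyclic_involution_even:
  assumes P: "P = product_group I (\<lambda>i. integer_mod_group (2 ^ e i))"
    and x: "x \<in> carrier P" and xx: "x \<otimes>\<^bsub>P\<^esub> x = \<one>\<^bsub>P\<^esub>" and i: "i \<in> I" "e i \<noteq> 1"
  shows "even (x i)"
proof (cases "e i = 0")
  case True
  have "x i \<in> {0..<2 ^ e i}"
    using x i(1) by (auto simp: P carrier_integer_mod_group PiE_iff)
  then have "0 \<le> x i" "x i < 1" using True by simp_all
  then have "x i = 0" by linarith
  then show ?thesis by simp
next
  case False
  then obtain k where k: "e i = Suc (Suc k)" using i by (metis One_nat_def not0_implies_Suc)
  have "(x i + x i) mod 2 ^ e i = 0"
    using fun_cong [OF xx, of i] i by (simp add: P)
  then have "2 * 2 ^ Suc k dvd 2 * x i" using k by (simp add: mod_eq_0_iff_dvd)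
  then have "2 ^ Suc k dvd x i" by (subst (asm) dvd_mult_cancel_left) simp
  then show ?thesis by (metis dvd_mult_left power_Suc)
qed

context central_involution
begin

text \<open>If \<epsilon> has a square root, this root gives the cochain. If not, u being a square
  in the commutative group S makes the parity vanish on S, and the zero map is a lift to be
  transferred.\<close>

lemma parity_form_self_coboundary_if_square:
  assumes S: "subgroup S G" "odd (card (rcosets\<^bsub>G\<^esub> S))"
    and comm: "\<And>s t. \<lbrakk>s \<in> S; t \<in> S\<rbrakk> \<Longrightarrow> s \<otimes>\<^bsub>G\<^esub> t = t \<otimes>\<^bsub>G\<^esub> s"
    and v: "v \<in> S" "v \<otimes>\<^bsub>G\<^esub> v = u" and \<sigma>: "\<sigma> \<in> twococycles G A"
  shows "parity_form \<sigma> \<sigma> \<in> twocoboundaries G A"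
proof (cases "\<exists>x\<in>carrier A. x \<otimes>\<^bsub>A\<^esub> x = \<epsilon>")
  case True
  then show ?thesis using parity_form_self_coboundary_sqrt [OF \<sigma>] by blast
next
  case False
  have "parity \<sigma> s = 0" if "s \<in> S" for s
    by (rule parity_of_square [OF \<sigma> _ _ comm v(2)])
      (use that v False subgroup.mem_carrier [OF S(1)] in auto)
  then show ?thesis
    by (intro parity_form_self_coboundary_odd_index [OF \<sigma> S, of "\<lambda>_. 0"]) simp_all
qed

text \<open>Only the first factor can have order 2, and its generator then has parity 0: the
  preimage of u squares to the identity, so it is a double up to that generator, and
  \<open>parity_of_involution\<close> applies. Hence the parity lifts modulo 4 on the product; the
  lift is carried to S and transferred to G.\<close>

lemma parity_form_self_coboundary_if_product:
  fixes r :: nat and e :: "nat \<Rightarrow> nat"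
  assumes S: "subgroup S G" "odd (card (rcosets\<^bsub>G\<^esub> S))"
    and comm: "\<And>s t. \<lbrakk>s \<in> S; t \<in> S\<rbrakk> \<Longrightarrow> s \<otimes>\<^bsub>G\<^esub> t = t \<otimes>\<^bsub>G\<^esub> s"
    and P: "P = product_group {1..r} (\<lambda>i. integer_mod_group (2 ^ e i))"
    and f: "f \<in> iso P (G\<lparr>carrier := S\<rparr>)" and e: "\<forall>i\<in>{2..r}. e i \<ge> 2"
    and \<sigma>: "\<sigma> \<in> twococycles G A"
  shows "parity_form \<sigma> \<sigma> \<in> twocoboundaries G A"
proof -
  have f_mult: "f (x \<otimes>\<^bsub>P\<^esub> y) = f x \<otimes>\<^bsub>G\<^esub> f y" if "x \<in> carrier P" "y \<in> carrier P" for x y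
    using f that by (auto simp: iso_def hom_def)
  have bij: "bij_betw f (carrier P) S" using f by (auto simp: iso_def)
  have fS: "f x \<in> S" if "x \<in> carrier P" for x using bij that by (auto simp: bij_betw_def)
  have SG: "s \<in> carrier G" if "s \<in> S" for s using subgroup.mem_carrier [OF S(1) that] .
  interpret P: group P unfolding P by (rule product_group) simp
  have f_one: "f \<one>\<^bsub>P\<^esub> = \<one>\<^bsub>G\<^esub>"
    using f_mult [of "\<one>\<^bsub>P\<^esub>" "\<one>\<^bsub>P\<^esub>"] SG [OF fS [of "\<one>\<^bsub>P\<^esub>"]] by (simp add: G.l_cancel_one)
  \<comment> \<open>Oddness of the index places u in S, so that u has coordinates in the
    product.\<close>
  have uS: "u \<in> S"
    using G.central_involution_in_odd_index [OF fin_G S u central uu] .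
  let ?I = "{1..r}" and ?n = "\<lambda>i. 2 ^ e i :: nat"
  let ?\<chi> = "\<lambda>x. int (parity \<sigma> (f x))"
  have \<chi>: "[?\<chi> (x \<otimes>\<^bsub>P\<^esub> y) = ?\<chi> x + ?\<chi> y] (mod 2)" if "x \<in> carrier P" "y \<in> carrier P" for x y
    unfolding f_mult [OF that] by (rule parity_cong [OF parity_mult [OF \<sigma>]]) (use that fS SG in auto)
  have "parity \<sigma> (f (cyclic_unit ?I ?n i 1)) = 0" if i: "i \<in> ?I" "e i = 1" for i
  proof -
    define a where "a = cyclic_unit ?I ?n i 1"
    have i1: "i = 1"
    proof (rule ccontr)
      assume "i \<noteq> 1"
      then have "i \<in> {2..r}" using i by auto
      then have "e i \<ge> 2" using e by blast
      then show False using i by simp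
    qed
    have a: "a \<in> carrier P" unfolding a_def P by (rule cyclic_unit_carrier) simp
    have aj: "a j = (if j = 1 then 1 else 0)" if "j \<in> ?I" for j
      using that i by (auto simp: a_def cyclic_unit_def i1)
    have aa: "a \<otimes>\<^bsub>P\<^esub> a = \<one>\<^bsub>P\<^esub>"
      using i by (auto simp: P aj i1)
    obtain x where x: "x \<in> carrier P" "f x = u"
      using bij uS by (auto simp: bij_betw_def)
    have "f (x \<otimes>\<^bsub>P\<^esub> x) = f \<one>\<^bsub>P\<^esub>" using x by (simp add: f_mult uu f_one)
    then have xx: "x \<otimes>\<^bsub>P\<^esub> x = \<one>\<^bsub>P\<^esub>"
      using bij x by (auto simp: bij_betw_def dest: inj_onD)
    \<comment> \<open>The first coordinate, the only one that can be odd, is removed from x; what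
      remains is even everywhere and hence a double.\<close>
    define y where "y = (\<lambda>j\<in>?I. if j = 1 then 0 else x j)"
    have y: "y \<in> carrier P"
      using x by (auto simp: y_def P PiE_iff carrier_integer_mod_group)
    have "even (y j)" if "j \<in> ?I" for j
    proof (cases "j = 1")
      case False
      then have "j \<in> {2..r}" using that by auto
      then have "e j \<ge> 2" using e by blast
      then have "e j \<noteq> 1" by simp
      then show ?thesis
        using product_cyclic_involution_even [OF P x(1) xx that] that False by (simp add: y_def)
    qed (use that in \<open>simp add: y_def\<close>)
    then obtain z where z: "z \<in> carrier P" "z \<otimes>\<^bsub>P\<^esub> z = y"
      using product_cyclic_half [OF P y] by blast
    \<comment> \<open>The first factor has order 2, so the removed coordinate is 0 or 1, and w is
      the identity or a accordingly.\<close>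
    have "x 1 \<in> {0..<2 ^ e 1}"
      using x(1) i(1) unfolding i1 by (auto simp: P PiE_iff carrier_integer_mod_group)
    then have "0 \<le> x 1" "x 1 < 2" using i(2) by (simp_all add: i1)
    then have x1: "x 1 = 0 \<or> x 1 = 1" by linarith
    have "x = \<one>\<^bsub>P\<^esub> \<otimes>\<^bsub>P\<^esub> y \<or> x = a \<otimes>\<^bsub>P\<^esub> y"
    proof -
      have "x = y" if "x 1 = 0"
        using that x(1) by (auto simp: y_def P PiE_iff extensional_def fun_eq_iff)
      moreover have "x = a \<otimes>\<^bsub>P\<^esub> y" if "x 1 = 1"
      proof
        show "x j = (a \<otimes>\<^bsub>P\<^esub> y) j" for j
          using that x(1) i by (cases "j \<in> ?I") (auto simp: aj y_def P PiE_iff extensional_def carrier_integer_mod_group i1)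
      qed
      ultimately show ?thesis using x1 y by auto
    qed
    then obtain w where w: "w = \<one>\<^bsub>P\<^esub> \<or> w = a" "x = w \<otimes>\<^bsub>P\<^esub> y" by blast
    show ?thesis
      unfolding a_def [symmetric]
    proof (rule parity_of_involution [OF \<sigma>, where v = "f z" and w = "f w"])
      show "f a \<in> carrier G" "f z \<in> carrier G" "f a \<otimes>\<^bsub>G\<^esub> f z = f z \<otimes>\<^bsub>G\<^esub> f a"
        using a z fS SG comm by auto
      show "f w \<in> {\<one>\<^bsub>G\<^esub>, f a}" using w f_one by auto
      show "f a \<otimes>\<^bsub>G\<^esub> f a = \<one>\<^bsub>G\<^esub>" using f_mult [OF a a] aa f_one by simp
      have "w \<in> carrier P" using w a by auto
      then show "u = f w \<otimes>\<^bsub>G\<^esub> (f z \<otimes>\<^bsub>G\<^esub> f z)"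
        using f_mult [of w y] f_mult [OF z(1,1)] z(2) y w(2) x(2) by simp
    qed
  qed
  then have even: "even (?\<chi> (cyclic_unit ?I ?n i 1))" if "i \<in> ?I" "e i = 1" for i
    using that by simp
  obtain \<psi> where \<psi>: "\<And>x y. \<lbrakk>x \<in> carrier P; y \<in> carrier P\<rbrakk> \<Longrightarrow> [\<psi> (x \<otimes>\<^bsub>P\<^esub> y) = \<psi> x + \<psi> y] (mod 4)"
    and lift: "\<And>x. x \<in> carrier P \<Longrightarrow> [\<psi> x = ?\<chi> x] (mod 2)"
    by (rule product_cyclic_lift_mod_4 [OF finite_atLeastAtMost P, of ?\<chi>])
      (blast intro: \<chi> even)+
  \<comment> \<open>The lift \<psi> lives on the product; composing it with the inverse of f gives a
    lift on S.\<close>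
  define f' where "f' = inv_into (carrier P) f"
  have f': "f' s \<in> carrier P" "f (f' s) = s" if "s \<in> S" for s
    using bij that by (auto simp: f'_def bij_betw_def inv_into_into f_inv_into_f)
  have f'_mult: "f' (s \<otimes>\<^bsub>G\<^esub> t) = f' s \<otimes>\<^bsub>P\<^esub> f' t" if "s \<in> S" "t \<in> S" for s t
  proof -
    have "s \<otimes>\<^bsub>G\<^esub> t = f (f' s \<otimes>\<^bsub>P\<^esub> f' t)" using that f' f_mult by simp
    then show ?thesis
      using f' that bij by (simp add: f'_def bij_betw_def inv_into_f_f)
  qed
  show ?thesis
  proof (rule parity_form_self_coboundary_odd_index [OF \<sigma> S, of "\<lambda>s. \<psi> (f' s)"])
    show "[\<psi> (f' (s \<otimes>\<^bsub>G\<^esub> t)) = \<psi> (f' s) + \<psi> (f' t)] (mod 4)" if "s \<in> S" "t \<in> S" for s t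
      using \<psi> f' f'_mult that by simp
    show "[\<psi> (f' s) = int (parity \<sigma> s)] (mod 2)" if "s \<in> S" for s
      using lift [OF f'(1) [OF that]] f'(2) [OF that] by simp
  qed
qed

end

text \<open>If -1 = 1, the characteristic divides 2 and is not 1, hence equals 2. But u has order 2,
  so 2 divides the order of G.\<close>

lemma minus_one_neq_one:
  assumes G: "group G" "finite (carrier G)" and u: "u \<in> carrier G" "u [^]\<^bsub>G\<^esub> (2::nat) = \<one>\<^bsub>G\<^esub>" "u \<noteq> \<one>\<^bsub>G\<^esub>"
    and K: "field K" and char: "ring_characteristic K = 0 \<or> \<not> ring_characteristic K dvd order G"
  shows "\<ominus>\<^bsub>K\<^esub> \<one>\<^bsub>K\<^esub> \<noteq> \<one>\<^bsub>K\<^esub>"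
proof
  assume eq: "\<ominus>\<^bsub>K\<^esub> \<one>\<^bsub>K\<^esub> = \<one>\<^bsub>K\<^esub>"
  interpret G: group G by (fact G)
  interpret K: field K by (fact K)
  note add = K.add.is_group
  have two: "d = 2" if "d dvd 2" "d \<noteq> 1" for d :: nat
    using that prime_nat_iff [of 2] two_is_prime_nat by blast
  have "\<one>\<^bsub>K\<^esub> \<oplus>\<^bsub>K\<^esub> \<one>\<^bsub>K\<^esub> = \<zero>\<^bsub>K\<^esub>"
    using K.l_neg [of "\<one>\<^bsub>K\<^esub>"] eq by simp
  then have "\<one>\<^bsub>K\<^esub> [^]\<^bsub>add_monoid K\<^esub> (2::nat) = \<one>\<^bsub>add_monoid K\<^esub>"
    by (simp add: numeral_2_eq_2)
  then have "ring_characteristic K dvd 2"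
    unfolding ring_characteristic_def using group.pow_eq_id [OF add, of "\<one>\<^bsub>K\<^esub>" 2] by simp
  moreover have "ring_characteristic K \<noteq> 1"
    unfolding ring_characteristic_def using group.ord_eq_1 [OF add, of "\<one>\<^bsub>K\<^esub>"] by simp
  ultimately have "ring_characteristic K = 2" using two by blast
  moreover have "G.ord u = 2"
    using u G.pow_eq_id [of u 2] G.ord_eq_1 [of u] two by blast
  then have "2 dvd order G" using G.ord_dvd_group_order [OF u(1)] by simp
  ultimately show False using char by simp
qed

theorem proposition2p3:
  fixes G :: "('a, 'm) monoid_scheme" and u :: 'a and K :: "('c, 'n) ring_scheme"
  assumes "group G" and "finite (carrier G)"
    and "u \<in> carrier G" and "\<forall>g\<in>carrier G. u \<otimes>\<^bsub>G\<^esub> g = g \<otimes>\<^bsub>G\<^esub> u"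
    and "u [^]\<^bsub>G\<^esub> (2::nat) = \<one>\<^bsub>G\<^esub>" and "u \<noteq> \<one>\<^bsub>G\<^esub>"
    and "field K"
    and "ring_characteristic K = 0 \<or> \<not> ring_characteristic K dvd order G"
  shows
    "((\<exists>x\<in>carrier K. x [^]\<^bsub>K\<^esub> (2::nat) = \<ominus>\<^bsub>K\<^esub> \<one>\<^bsub>K\<^esub>)
        \<longrightarrow> H2 G (Multiplicative_Group.mult_of K) \<cong> H2_sharp G u K)
     \<and> (\<forall>S. nilpotent_group G \<and> sylow_subgroup 2 S G \<and> comm_group (G\<lparr>carrier := S\<rparr>)
          \<and> (\<exists>P (r::nat) (e::nat \<Rightarrow> nat). subgroup P (G\<lparr>carrier := S\<rparr>) \<and> u \<in> P
               \<and> G\<lparr>carrier := P\<rparr> \<cong> product_group {1..r} (\<lambda>i. integer_mod_group (2 ^ e i))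
               \<and> (\<forall>i\<in>{1..r}. \<not> integer_mod_group (2 ^ e i) \<cong> integer_mod_group 2))
        \<longrightarrow> H2 G (Multiplicative_Group.mult_of K) \<cong> H2_sharp G u K)
     \<and> (\<forall>S. nilpotent_group G \<and> sylow_subgroup 2 S G \<and> comm_group (G\<lparr>carrier := S\<rparr>)
          \<and> (\<exists>(r::nat) (e::nat \<Rightarrow> nat).
               G\<lparr>carrier := S\<rparr> \<cong> product_group {1..r} (\<lambda>i. integer_mod_group (2 ^ e i))
               \<and> (\<forall>i\<in>{2..r}. e i \<ge> 2))
        \<longrightarrow> H2 G (Multiplicative_Group.mult_of K) \<cong> H2_sharp G u K)"
proof -
  interpret G: group G by fact
  interpret K: field K by fact
  let ?A = "Multiplicative_Group.mult_of K" and ?\<epsilon> = "\<ominus>\<^bsub>K\<^esub> \<one>\<^bsub>K\<^esub>"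
  have \<epsilon>_neq: "?\<epsilon> \<noteq> \<one>\<^bsub>K\<^esub>" using assms by (intro minus_one_neq_one [of G u K]) auto
  have \<epsilon>: "?\<epsilon> \<in> carrier ?A"
    using K.l_neg [of "\<one>\<^bsub>K\<^esub>"] by auto
  have comm_A: "comm_group ?A"
    by (rule group.group_comm_groupI [OF K.field_mult_group]) (simp add: K.m_comm)
  \<comment> \<open>A is the multiplicative group of K with -1 as \<epsilon>; in a field 1 and -1
    are the only square roots of 1.\<close>
  interpret central_involution G ?A u ?\<epsilon>
  proof (intro central_involution.intro trivial_module.intro central_involution_axioms.intro)
    show "u \<otimes>\<^bsub>G\<^esub> u = \<one>\<^bsub>G\<^esub>" using assms(3,5) by (simp add: numeral_2_eq_2)
    show "?\<epsilon> \<otimes>\<^bsub>?A\<^esub> ?\<epsilon> = \<one>\<^bsub>?A\<^esub>" by (simp add: K.l_minus K.r_minus)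
    fix a assume a: "a \<in> carrier ?A" "a \<otimes>\<^bsub>?A\<^esub> a = \<one>\<^bsub>?A\<^esub>"
    then show "a = \<one>\<^bsub>?A\<^esub> \<or> a = ?\<epsilon>" using K.square_eq_one [of a] by auto
  qed (use assms comm_A \<epsilon> \<epsilon>_neq in \<open>auto simp: G.is_group\<close>)
  \<comment> \<open>Products and powers of units are the same in K and in its multiplicative group,
    so the two notions of parity agree and \<open>Z2_sharp\<close> equals
    \<open>Z2_twisted\<close>.\<close>
  have "cocycle_parity K u \<sigma> g = parity \<sigma> g" for \<sigma> :: "'a \<times> 'a \<Rightarrow> 'c" and g
    by (simp add: cocycle_parity_def parity_def Multiplicative_Group.nat_pow_mult_of)
  then have "Z2_sharp G u K = Z2_twisted"
    unfolding Z2_sharp_def Z2_twisted_def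
    by (simp add: mult_Z2 sign_form_def fun_eq_iff restrict_def Multiplicative_Group.nat_pow_mult_of)
  \<comment> \<open>In each of the three cases it is now enough to exhibit every diagonal form as a
    coboundary.\<close>
  then have iso: "H2 G ?A \<cong> H2_sharp G u K"
    if "\<And>\<sigma>. \<sigma> \<in> twococycles G ?A \<Longrightarrow> parity_form \<sigma> \<sigma> \<in> twocoboundaries G ?A"
    using H2_iso_twisted [OF that] by (simp add: H2_sharp_def)
  have S: "subgroup S G" "odd (card (rcosets\<^bsub>G\<^esub> S))" if "sylow_subgroup 2 S G" for S
    using that G.sylow_subgroup_odd_index [OF assms(2) that] by (auto simp: sylow_subgroup_def)
  have comm: "s \<otimes>\<^bsub>G\<^esub> t = t \<otimes>\<^bsub>G\<^esub> s" if "comm_group (G\<lparr>carrier := S\<rparr>)" "s \<in> S" "t \<in> S" for S s t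
    using comm_groupE(4) [OF that(1)] that(2,3) by simp
  have "H2 G ?A \<cong> H2_sharp G u K" if x: "x \<in> carrier K" "x [^]\<^bsub>K\<^esub> (2::nat) = ?\<epsilon>" for x
  proof (rule iso)
    have xx: "x \<otimes>\<^bsub>K\<^esub> x = ?\<epsilon>" using x by (simp add: numeral_2_eq_2)
    moreover have "x \<noteq> \<zero>\<^bsub>K\<^esub>"
    proof
      assume "x = \<zero>\<^bsub>K\<^esub>"
      then have "?\<epsilon> = \<zero>\<^bsub>K\<^esub>" using xx by simp
      then show False using \<epsilon> by simp
    qed
    ultimately have "x \<in> carrier ?A" "x \<otimes>\<^bsub>?A\<^esub> x = ?\<epsilon>" using x by simp_all
    then show "parity_form \<sigma> \<sigma> \<in> twocoboundaries G ?A" if "\<sigma> \<in> twococycles G ?A" for \<sigma>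
      using parity_form_self_coboundary_sqrt [OF that] by blast
  qed
  moreover have "H2 G ?A \<cong> H2_sharp G u K"
    if syl: "sylow_subgroup 2 S G" and cS: "comm_group (G\<lparr>carrier := S\<rparr>)"
      and P: "subgroup P (G\<lparr>carrier := S\<rparr>)" "u \<in> P"
      and isoP: "G\<lparr>carrier := P\<rparr> \<cong> product_group {1..r} (\<lambda>i. integer_mod_group (2 ^ e i))" (is "_ \<cong> ?P")
      and e: "\<forall>i\<in>{1..r}. \<not> integer_mod_group (2 ^ e i) \<cong> integer_mod_group 2"
    for S P and r :: nat and e :: "nat \<Rightarrow> nat"
  proof (rule iso)
    fix \<sigma> assume \<sigma>: "\<sigma> \<in> twococycles G ?A"
    have PS: "P \<subseteq> S" using subgroup.subset [OF P(1)] by simp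
    have PG: "subgroup P G" using G.incl_subgroup [OF S(1) [OF syl] P(1)] .
    interpret P: group "?P" by (rule product_group) simp
    obtain f where f: "f \<in> iso (G\<lparr>carrier := P\<rparr>) ?P" using isoP by (auto simp: is_iso_def)
    have f_mult: "f (x \<otimes>\<^bsub>G\<^esub> y) = f x \<otimes>\<^bsub>?P\<^esub> f y" if "x \<in> P" "y \<in> P" for x y
      using f that by (auto simp: iso_def hom_def)
    have bij: "bij_betw f P (carrier ?P)" using f by (auto simp: iso_def)
    have fu: "f u \<in> carrier ?P" using bij P(2) by (auto simp: bij_betw_def)
    have "f \<one>\<^bsub>G\<^esub> = \<one>\<^bsub>?P\<^esub>"
      using hom_one [of f "G\<lparr>carrier := P\<rparr>" ?P] f G.subgroup_imp_group [OF PG] P.is_group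
      by (simp add: iso_def)
    then have fuu: "f u \<otimes>\<^bsub>?P\<^esub> f u = \<one>\<^bsub>?P\<^esub>"
      using f_mult [OF P(2,2)] uu by simp
    \<comment> \<open>Excluding factors isomorphic to the integers modulo 2 excludes the exponent 1;
      trivial factors with exponent 0 remain possible.\<close>
    have "e i \<noteq> 1" if "i \<in> {1..r}" for i
      using e that iso_refl by (metis power_one_right)
    \<comment> \<open>The image of u squares to the identity, so its coordinates are even and it is
      a double. The half pulls back to an element v of P whose square is u.\<close>
    then obtain y where y: "y \<in> carrier ?P" "y \<otimes>\<^bsub>?P\<^esub> y = f u"
      using product_cyclic_half [OF refl fu] product_cyclic_involution_even [OF refl fu fuu] by metis
    have "y \<in> f ` P" using bij y(1) unfolding bij_betw_def by blast
    then obtain v where v: "v \<in> P" "f v = y" by blast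
    have "f (v \<otimes>\<^bsub>G\<^esub> v) = f u" using f_mult v y by simp
    then have "v \<otimes>\<^bsub>G\<^esub> v = u"
      using bij P(2) v(1) subgroup.m_closed [OF PG] by (auto simp: bij_betw_def dest: inj_onD)
    then show "parity_form \<sigma> \<sigma> \<in> twocoboundaries G ?A"
      using v(1) PS by (intro parity_form_self_coboundary_if_square [OF S [OF syl] comm [OF cS] _ _ \<sigma>]) auto
  qed
  moreover have "H2 G ?A \<cong> H2_sharp G u K"
    if syl: "sylow_subgroup 2 S G" and cS: "comm_group (G\<lparr>carrier := S\<rparr>)"
      and isoS: "G\<lparr>carrier := S\<rparr> \<cong> product_group {1..r} (\<lambda>i. integer_mod_group (2 ^ e i))" (is "_ \<cong> ?P")
      and e: "\<forall>i\<in>{2..r}. e i \<ge> 2"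
    for S and r :: nat and e :: "nat \<Rightarrow> nat"
  proof (rule iso)
    fix \<sigma> assume \<sigma>: "\<sigma> \<in> twococycles G ?A"
    have "?P \<cong> G\<lparr>carrier := S\<rparr>"
      using group.iso_sym [OF G.subgroup_imp_group [OF S(1) [OF syl]] isoS] .
    then obtain f where "f \<in> iso ?P (G\<lparr>carrier := S\<rparr>)" by (auto simp: is_iso_def)
    from parity_form_self_coboundary_if_product [OF S [OF syl] comm [OF cS] refl this e \<sigma>]
    show "parity_form \<sigma> \<sigma> \<in> twocoboundaries G ?A" .
  qed
  ultimately show ?thesis by blast
qed

end
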